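(* Let $k\geq 1$ be a fixed integer, let $\varepsilon>0$, and let $$p=\left(\frac{2\ln n+\omega(1)}{n^{k+1}}\right)^{1/(k+2)}.$$ Then whp $G_n\sim G(n,p)$ has query complexity at least $\dfrac{1}{2(k+1+\varepsilon)n^{k-2}p^k}$.
   Context: $[n]:=\{1,\ldots,n\}$. $G(n,p)$ is the binomial random graph on vertex set $[n]$: each pair of vertices is an edge independently with probability $p=p(n)\in[0,1]$. "Whp" (with high probability) means with probability tending to $1$ as $n\to\infty$. $\omega(1)$ stands for a function of $n$ tending to infinity as $n\to\infty$ (arbitrarily slowly or fast). For a graph $G$ on $[n]$, $d_G(x,y)$ is the graph distance between $x$ and $y$ in $G$ ($\infty$ if they lie in different components). A set $\mathcal{Q}\subset\binom{[n]}{2}$ of pairs of vertices reconstructs a graph $G$ on $[n]$ if for every graph $G'$ on $[n]$ such that $d_{G'}(x,y)=d_G(x,y)$ for all $\{x,y\}\in\mathcal{Q}$, we have $G'=G$. Distance query model: there is a hidden unknown graph $G$ on $[n]$, and an oracle which, for every queried pair of vertices $\{x,y\}$, answers $d_G(x,y)$. An adaptive algorithm at every step selects the next query (a pair of vertices) based on the responses of the oracle to earlier queries. A graph $G$ on $[n]$ is $q$-reconstructible by an adaptive algorithm $\mathtt{A}$ if, for the hidden input graph $G$, $\mathtt{A}$ queries at most $q$ pairs, comprising a set $\mathcal{Q}\subset\binom{[n]}{2}$ that reconstructs $G$. The (distance) query complexity of $G$ is the minimum $q$ such that $G$ is $q$-reconstructible by some adaptive algorithm (which may depend on $G$). *)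

theory Defs
  imports "HOL-Probability.Probability" "HOL-Probability.Product_PMF" "HOL-Library.Extended_Nat"
begin

text \<open>A simple graph on \<open>{1..n}\<close> is given by its set of edges, a subset of \<open>all_pairs n\<close>.\<close>

definition all_pairs :: "nat \<Rightarrow> nat set set" where
  "all_pairs n = {e. e \<subseteq> {1..n} \<and> card e = 2}"

text \<open>The minimum length of a walk; the infimum of the empty set is \<open>\<infinity>\<close>.\<close>

definition graph_dist :: "nat set set \<Rightarrow> nat \<Rightarrow> nat \<Rightarrow> enat" where
  "graph_dist E x y = Inf {enat m |m. (x, y) \<in> {(u, v). {u, v} \<in> E} ^^ m}"

definition gnp :: "nat \<Rightarrow> real \<Rightarrow> nat set set pmf" where
  "gnp n p = map_pmf (\<lambda>f. {e \<in> all_pairs n. f e})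
     (Pi_pmf (all_pairs n) False (\<lambda>_. bernoulli_pmf p))"

definition reconstructs :: "nat \<Rightarrow> nat set set \<Rightarrow> nat set set \<Rightarrow> bool" where
  "reconstructs n Q E \<longleftrightarrow>
     (\<forall>E' \<subseteq> all_pairs n.
        (\<forall>x y. {x, y} \<in> Q \<longrightarrow> graph_dist E' x y = graph_dist E x y) \<longrightarrow> E' = E)"

text \<open>A history lists the queries made so far, oldest first, each with the answer of the oracle.
  From it an algorithm determines the next query, or stops with \<open>None\<close>.\<close>

type_synonym history = "((nat \<times> nat) \<times> enat) list"
type_synonym algorithm = "history \<Rightarrow> (nat \<times> nat) option"

definition adaptive_algorithm :: "nat \<Rightarrow> algorithm \<Rightarrow> bool" where
  "adaptive_algorithm n A \<longleftrightarrow> (\<forall>h x y. A h = Some (x, y) \<longrightarrow> {x, y} \<in> all_pairs n)"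

text \<open>The history after \<open>t\<close> steps with hidden graph \<open>E\<close>; it no longer changes once the
  algorithm has stopped.\<close>

primrec run :: "algorithm \<Rightarrow> nat set set \<Rightarrow> nat \<Rightarrow> history" where
  "run A E 0 = []"
| "run A E (Suc t) = (case A (run A E t) of
       None \<Rightarrow> run A E t
     | Some (x, y) \<Rightarrow> run A E t @ [((x, y), graph_dist E x y)])"

definition queried :: "history \<Rightarrow> nat set set" where
  "queried h = (\<lambda>((x, y), d). {x, y}) ` set h"

definition reconstructible_by :: "nat \<Rightarrow> algorithm \<Rightarrow> nat \<Rightarrow> nat set set \<Rightarrow> bool" where
  "reconstructible_by n A q E \<longleftrightarrow>
     (\<exists>t. A (run A E t) = None \<and> length (run A E t) \<le> q \<and> reconstructs n (queried (run A E t)) E)"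

definition query_complexity :: "nat \<Rightarrow> nat set set \<Rightarrow> nat" where
  "query_complexity n E = (LEAST q. \<exists>A. adaptive_algorithm n A \<and> reconstructible_by n A q E)"

text \<open>The minimum is attained: querying all pairs always reconstructs the graph.\<close>

lemma graph_dist_eq_1_iff:
  assumes "x \<noteq> y"
  shows "graph_dist E x y = 1 \<longleftrightarrow> {x, y} \<in> E"
proof
  define S where "S = {enat m |m. (x, y) \<in> {(u, v). {u, v} \<in> E} ^^ m}"
  assume "graph_dist E x y = 1"
  then have "Inf S = 1" by (simp add: graph_dist_def S_def)
  moreover have "S \<noteq> {}" using calculation by (metis Inf_empty infinity_ne_i1 top_enat_def)
  then have "Inf S \<in> S" by (metis Inf_enat_def LeastI_ex ex_in_conv)
  ultimately have "(x, y) \<in> {(u, v). {u, v} \<in> E} ^^ 1"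
    by (auto simp: S_def one_enat_def)
  then show "{x, y} \<in> E" by simp
next
  assume e: "{x, y} \<in> E"
  have "graph_dist E x y \<le> enat 1"
    unfolding graph_dist_def by (rule Inf_lower) (use e in auto)
  moreover have "enat 1 \<le> graph_dist E x y"
    unfolding graph_dist_def
  proof (rule Inf_greatest)
    fix z assume "z \<in> {enat m |m. (x, y) \<in> {(u, v). {u, v} \<in> E} ^^ m}"
    then obtain m where m: "z = enat m" "(x, y) \<in> {(u, v). {u, v} \<in> E} ^^ m" by blast
    then have "m \<noteq> 0" using assms by (cases m) auto
    then show "enat 1 \<le> z" using m by simp
  qed
  ultimately show "graph_dist E x y = 1" by (simp add: one_enat_def)
qed

lemma reconstructs_all_pairs:
  assumes "E \<subseteq> all_pairs n"
  shows "reconstructs n (all_pairs n) E"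
  unfolding reconstructs_def
proof (intro allI impI)
  fix E' assume E': "E' \<subseteq> all_pairs n"
    and eq: "\<forall>x y. {x, y} \<in> all_pairs n \<longrightarrow> graph_dist E' x y = graph_dist E x y"
  have "e \<in> E' \<longleftrightarrow> e \<in> E" if e: "e \<in> all_pairs n" for e
  proof -
    obtain x y where "e = {x, y}" "x \<noteq> y"
      using e unfolding all_pairs_def card_2_iff by blast
    then show ?thesis
      using eq e graph_dist_eq_1_iff[of x y E] graph_dist_eq_1_iff[of x y E'] by auto
  qed
  then show "E' = E" using E' assms by blast
qed

lemma query_complexity_attained:
  assumes "E \<subseteq> all_pairs n"
  shows "\<exists>A. adaptive_algorithm n A \<and> reconstructible_by n A (query_complexity n E) E"
proof -
  define P where "P = {(x, y). x \<in> {1..n} \<and> y \<in> {1..n} \<and> x \<noteq> y}"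
  have "finite P" by (rule finite_subset[of _ "{1..n} \<times> {1..n}"]) (auto simp: P_def)
  then obtain xs where xs: "set xs = P" using finite_list by blast
  define A :: algorithm where
    "A = (\<lambda>h. if length h < length xs then Some (xs ! length h) else None)"
  have run: "run A E t = map (\<lambda>(x, y). ((x, y), graph_dist E x y)) (take t xs)" for t
  proof (induction t)
    case (Suc t)
    then show ?case
      by (cases "t < length xs") (auto simp: A_def take_Suc_conv_app_nth min_def split: prod.splits)
  qed simp
  have "adaptive_algorithm n A"
    unfolding adaptive_algorithm_def
  proof (intro allI impI)
    fix h x y assume "A h = Some (x, y)"
    then have "(x, y) \<in> set xs" by (metis A_def nth_mem option.distinct(1) option.inject)
    then show "{x, y} \<in> all_pairs n" by (auto simp: xs P_def all_pairs_def)
  qed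
  moreover have "reconstructible_by n A (length xs) E"
    unfolding reconstructible_by_def
  proof (intro exI[of _ "length xs"] conjI)
    have len: "length (run A E (length xs)) = length xs"
      by (simp add: run)
    then show "length (run A E (length xs)) \<le> length xs" by simp
    show "A (run A E (length xs)) = None"
      using len by (subst A_def) simp
    have "all_pairs n = (\<lambda>(x, y). {x, y}) ` P"
    proof (intro set_eqI iffI)
      fix e assume e: "e \<in> all_pairs n"
      then obtain x y where "e = {x, y}" "x \<noteq> y"
        unfolding all_pairs_def card_2_iff by blast
      then show "e \<in> (\<lambda>(x, y). {x, y}) ` P"
        using e by (intro image_eqI[of _ _ "(x, y)"]) (simp_all add: P_def all_pairs_def)
    qed (auto simp: P_def all_pairs_def)
    moreover have "queried (run A E (length xs)) = (\<lambda>(x, y). {x, y}) ` P"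
      by (simp add: queried_def run xs image_image case_prod_unfold)
    ultimately show "reconstructs n (queried (run A E (length xs))) E"
      using reconstructs_all_pairs[OF assms] by simp
  qed
  ultimately have "\<exists>q A. adaptive_algorithm n A \<and> reconstructible_by n A q E" by blast
  then show ?thesis
    unfolding query_complexity_def
    by (rule LeastI_ex)
qed

end

theory Submission imports Defs "HOL-Real_Asymp.Real_Asymp" begin

text \<open>
  Suppose that the distances of a set of queries determine a graph with maximum degree at most \<open>D\<close>
  and diameter at most \<open>k + 2\<close>. Inserting a non-edge \<open>uv\<close> must shorten the distance of some query
  \<open>xy\<close>, so one of \<open>u\<close>, \<open>v\<close> is within distance \<open>i\<close> of \<open>x\<close> and the other within \<open>j\<close> of \<open>y\<close>, where
  \<open>i + j \<le> k\<close>. Up to lower order terms there are at most \<open>(k + 1) * D ^ k\<close> such pairs for each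
  query. In a sparse random graph \<open>D\<close> is about \<open>n * p\<close> and about \<open>n\<^sup>2 / 2\<close> pairs are
  non-edges, and the quotient is the claimed bound (\<open>card_nonedges_le\<close>,
  \<open>sparse_query_complexity_ge\<close>).

  The diameter is where the hypothesis on \<open>p\<close> enters. With high probability all vertex sets \<open>A\<close> with
  \<open>card A * p\<close> small have at least nearly \<open>n * p * card A\<close> neighbours outside \<open>A\<close> (\<open>prob_not_expanding\<close>).
  Hence the ball of radius \<open>k + 1\<close> around \<open>x\<close>, explored without using \<open>y\<close>, has at least nearly
  \<open>(n * p) ^ (k + 1)\<close> elements, unless it saturates at a size that is large enough anyway (\<open>card_ball_ge\<close>). The edges at \<open>y\<close>
  are independent of this exploration and all miss the ball with probability at most about
  \<open>exp (- (n ^ (k + 1) * p ^ (k + 2))) = exp (- (2 * ln n + \<omega> n))\<close>, which is smaller than the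
  reciprocal of the number of pairs \<open>xy\<close> (\<open>prob_far_apart\<close>, \<open>far_pairs_vanish\<close>). The relative error
  \<open>\<eta>\<close> in the expansion must tend to 0 faster than \<open>1 / ln n\<close> for this; it must also be large enough
  for the large deviation bounds, which need \<open>\<eta>\<^sup>2 * n * p\<close> to exceed a multiple of \<open>ln n\<close>. As
  \<open>n * p\<close> is at least a power of \<open>n\<close>, the choice \<open>\<eta> = 1 / (ln n)\<^sup>2\<close> meets both demands.

  Since \<open>\<omega>\<close> may grow arbitrarily fast, \<open>p\<close> need not tend to 0, and a dense graph has too few non-edges
  for the counting argument. If \<open>p > \<eta>\<close>, however, with high probability every two vertices have at least
  two common neighbours. Then changing a single pair affects no other distance, and all pairs must be
  queried (\<open>reconstructs_imp_all_pairs\<close>).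
\<close>

section \<open>Pairs of vertices\<close>

lemma finite_all_pairs [simp]: "finite (all_pairs n)"
  unfolding all_pairs_def by (rule finite_subset[of _ "Pow {1..n}"]) auto

lemma card_all_pairs: "card (all_pairs n) = n choose 2"
  unfolding all_pairs_def by (simp add: n_subsets)

lemma all_pairsE:
  assumes "e \<in> all_pairs n"
  obtains x y where "e = {x, y}" "x \<noteq> y" "x \<in> {1..n}" "y \<in> {1..n}"
  using assms unfolding all_pairs_def card_2_iff by auto

lemma in_all_pairs [simp]:
  "{x, y} \<in> all_pairs n \<longleftrightarrow> x \<in> {1..n} \<and> y \<in> {1..n} \<and> x \<noteq> y"
  by (auto simp: all_pairs_def card_2_iff doubleton_eq_iff)

lemma real_card_all_pairs: "real (card (all_pairs n)) = real n * (real n - 1) / 2"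
proof -
  have "even (n * (n - 1))" by (cases n) auto
  then show ?thesis
    unfolding card_all_pairs choose_two by (cases n) (auto simp: real_of_nat_div algebra_simps)
qed

section \<open>Walks and distances\<close>

definition adj :: "nat set set \<Rightarrow> (nat \<times> nat) set" where
  "adj E = {(u, v). {u, v} \<in> E}"

lemma adj_iff [simp]: "(u, v) \<in> adj E \<longleftrightarrow> {u, v} \<in> E"
  by (simp add: adj_def)

lemma walk_mono: "(x, y) \<in> adj E ^^ m \<Longrightarrow> E \<subseteq> E' \<Longrightarrow> (x, y) \<in> adj E' ^^ m"
proof (induction m arbitrary: y)
  case (Suc m)
  then obtain z where "(x, z) \<in> adj E ^^ m" "{z, y} \<in> E" by auto
  moreover from this have "(x, z) \<in> adj E' ^^ m" using Suc by blast
  moreover from calculation have "{z, y} \<in> E'" using Suc.prems(2) by blast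
  ultimately show ?case by (auto intro: relcompI)
qed auto

lemma sym_walk: "(x, y) \<in> adj E ^^ m \<Longrightarrow> (y, x) \<in> adj E ^^ m"
proof (induction m arbitrary: y)
  case (Suc m)
  then obtain z where "(x, z) \<in> adj E ^^ m" "{z, y} \<in> E" by auto
  with Suc.IH show ?case
    by (metis adj_iff insert_commute relpow_Suc_I2)
qed auto

lemma graph_dist_le_iff:
  "graph_dist E x y \<le> enat m \<longleftrightarrow> (\<exists>i\<le>m. (x, y) \<in> adj E ^^ i)"
proof
  define S where "S = {enat i |i. (x, y) \<in> adj E ^^ i}"
  have d: "graph_dist E x y = Inf S"
    by (simp add: graph_dist_def S_def adj_def)
  assume le: "graph_dist E x y \<le> enat m"
  then have "S \<noteq> {}" by (auto simp: d Inf_enat_def)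
  then have "Inf S \<in> S" by (metis Inf_enat_def LeastI_ex ex_in_conv)
  with le show "\<exists>i\<le>m. (x, y) \<in> adj E ^^ i" by (auto simp: d S_def)
next
  assume "\<exists>i\<le>m. (x, y) \<in> adj E ^^ i"
  then obtain i where i: "i \<le> m" "(x, y) \<in> adj E ^^ i" by blast
  then have "graph_dist E x y \<le> enat i"
    unfolding graph_dist_def by (intro Inf_lower) (auto simp: adj_def)
  with i show "graph_dist E x y \<le> enat m" by (metis enat_ord_simps(1) order_trans)
qed

lemma graph_dist_antimono:
  assumes "E \<subseteq> E'"
  shows "graph_dist E' x y \<le> graph_dist E x y"
proof (cases "graph_dist E x y")
  case (enat m)
  then show ?thesis
    using graph_dist_le_iff[of E x y m] graph_dist_le_iff[of E' x y m]
      walk_mono[OF _ assms] by (metis order_refl)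
qed simp

text \<open>A walk that uses the new edge more than once can be shortened to one that uses it at most
  once, so a walk in the larger graph is at least as long as a walk in the old graph, or as two
  walks in the old graph joined by one passage through the new edge.\<close>

lemma walk_insert_edge:
  assumes "(x, y) \<in> adj (insert {u, v} E) ^^ m"
  shows "(\<exists>l\<le>m. (x, y) \<in> adj E ^^ l) \<or>
    (\<exists>i j. i + j < m \<and> ((x, u) \<in> adj E ^^ i \<and> (v, y) \<in> adj E ^^ j
                        \<or> (x, v) \<in> adj E ^^ i \<and> (u, y) \<in> adj E ^^ j))"
  using assms
proof (induction m arbitrary: y)
  case (Suc m)
  then obtain z where z: "(x, z) \<in> adj (insert {u, v} E) ^^ m" "{z, y} \<in> insert {u, v} E"
    by auto
  note IH = Suc.IH[OF z(1)]
  show ?case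
  proof (cases "{z, y} \<in> E")
    case True
    have step: "(a, y) \<in> adj E ^^ Suc i" if "(a, z) \<in> adj E ^^ i" for a i
      using that True by auto
    from IH show ?thesis
    proof (elim disjE exE conjE)
      fix l assume "l \<le> m" "(x, z) \<in> adj E ^^ l"
      then show ?thesis using step by (meson Suc_le_mono)
    next
      fix i j assume "i + j < m" "(x, u) \<in> adj E ^^ i" "(v, z) \<in> adj E ^^ j"
      then show ?thesis using step[of v j] by (intro disjI2 exI[of _ i] exI[of _ "Suc j"]) auto
    next
      fix i j assume "i + j < m" "(x, v) \<in> adj E ^^ i" "(u, z) \<in> adj E ^^ j"
      then show ?thesis using step[of u j] by (intro disjI2 exI[of _ i] exI[of _ "Suc j"]) auto
    qed
  next
    case False
    then have e: "z = u \<and> y = v \<or> z = v \<and> y = u" using z(2) by (auto simp: doubleton_eq_iff)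
    have triv: "(y, y) \<in> adj E ^^ 0" by simp
    from IH show ?thesis
    proof (elim disjE exE conjE)
      fix l assume l: "l \<le> m" "(x, z) \<in> adj E ^^ l"
      show ?thesis
        using e l triv by (intro disjI2 exI[of _ l] exI[of _ 0]) auto
    next
      fix i j assume ij: "i + j < m" "(x, u) \<in> adj E ^^ i" "(v, z) \<in> adj E ^^ j"
      from e show ?thesis
      proof
        assume "z = u \<and> y = v"
        then show ?thesis
          using ij triv by (intro disjI2 exI[of _ i] exI[of _ 0]) auto
      next
        assume "z = v \<and> y = u"
        then show ?thesis
          using ij by (intro disjI1 exI[of _ i]) auto
      qed
    next
      fix i j assume ij: "i + j < m" "(x, v) \<in> adj E ^^ i" "(u, z) \<in> adj E ^^ j"
      from e show ?thesis
      proof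
        assume "z = u \<and> y = v"
        then show ?thesis
          using ij by (intro disjI1 exI[of _ i]) auto
      next
        assume "z = v \<and> y = u"
        then show ?thesis
          using ij triv by (intro disjI2 exI[of _ i] exI[of _ 0]) auto
      qed
    qed
  qed
qed auto

section \<open>Pairs of vertices settled by a query\<close>

definition walk_ends :: "nat set set \<Rightarrow> nat \<Rightarrow> nat \<Rightarrow> nat set" where
  "walk_ends E x i = (adj E ^^ i) `` {x}"

text \<open>The pairs whose insertion can shorten the distance between \<open>x\<close> and \<open>y\<close> when that distance is at
  most \<open>k + 2\<close>: the new shortest walk leaves at most \<open>k\<close> steps for the two parts outside the new edge.\<close>

definition covered :: "nat set set \<Rightarrow> nat \<Rightarrow> nat \<Rightarrow> nat \<Rightarrow> nat set set" where
  "covered E k x y = (\<Union>i\<le>k. \<Union>j\<le>k - i. (\<lambda>(u, v). {u, v}) ` (walk_ends E x i \<times> walk_ends E y j))"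

lemma covered_commute: "covered E k x y = covered E k y x"
proof -
  have "covered E k x y \<subseteq> covered E k y x" for x y
  proof
    fix e assume "e \<in> covered E k x y"
    then obtain i j u v where "i \<le> k" "j \<le> k - i" "e = {u, v}" "u \<in> walk_ends E x i" "v \<in> walk_ends E y j"
      unfolding covered_def by auto
    then show "e \<in> covered E k y x"
      unfolding covered_def
      by (intro UN_I[of j] UN_I[of i] image_eqI[of _ _ "(v, u)"]) (auto simp: insert_commute)
  qed
  then show ?thesis by blast
qed

lemma nonedge_covered:
  assumes "graph_dist (insert {u, v} E) x y \<noteq> graph_dist E x y"
    and "graph_dist E x y \<le> enat (k + 2)"
  shows "{u, v} \<in> covered E k x y"
proof -
  have lt: "graph_dist (insert {u, v} E) x y < graph_dist E x y"
    using assms(1) graph_dist_antimono[OF subset_insertI] by (metis order_le_imp_less_or_eq)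
  then obtain m where m: "graph_dist (insert {u, v} E) x y = enat m"
    by (cases "graph_dist (insert {u, v} E) x y") auto
  have mk: "m \<le> k + 1"
    using lt assms(2) unfolding m
    by (metis Suc_eq_plus1 add_2_eq_Suc' enat_ord_simps(2) less_Suc_eq_le order_less_le_trans)
  from m obtain m' where m': "m' \<le> m" "(x, y) \<in> adj (insert {u, v} E) ^^ m'"
    using graph_dist_le_iff by (metis order_refl)
  have "\<not> (\<exists>l\<le>m. (x, y) \<in> adj E ^^ l)"
    using lt unfolding graph_dist_le_iff[symmetric] m by simp
  with walk_insert_edge[OF m'(2)] m'(1) obtain i j where ij: "i + j < m'"
    "(x, u) \<in> adj E ^^ i \<and> (v, y) \<in> adj E ^^ j \<or> (x, v) \<in> adj E ^^ i \<and> (u, y) \<in> adj E ^^ j"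
    by (metis order_trans)
  from ij(1) m'(1) mk have le: "i \<le> k" "j \<le> k - i" by auto
  from ij(2) show ?thesis
  proof
    assume "(x, u) \<in> adj E ^^ i \<and> (v, y) \<in> adj E ^^ j"
    then show ?thesis
      unfolding covered_def walk_ends_def using le sym_walk
      by (intro UN_I[of i] UN_I[of j] image_eqI[of _ _ "(u, v)"]) auto
  next
    assume "(x, v) \<in> adj E ^^ i \<and> (u, y) \<in> adj E ^^ j"
    then show ?thesis
      unfolding covered_def walk_ends_def using le sym_walk
      by (intro UN_I[of i] UN_I[of j] image_eqI[of _ _ "(v, u)"]) auto
  qed
qed

lemma neighbours_subset: "E \<subseteq> all_pairs n \<Longrightarrow> adj E `` {x} \<subseteq> {1..n}"
  by (auto simp: all_pairs_def)

lemma real_card_UN_le: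
  "finite I \<Longrightarrow> real (card (\<Union>i\<in>I. A i)) \<le> (\<Sum>i\<in>I. real (card (A i)))"
  unfolding of_nat_sum[symmetric] of_nat_le_iff by (rule card_UN_le)

lemma card_walk_ends_le:
  assumes E: "E \<subseteq> all_pairs n" and D: "\<And>x. real (card (adj E `` {x})) \<le> D"
  shows "finite (walk_ends E x i) \<and> real (card (walk_ends E x i)) \<le> D ^ i"
proof (induction i)
  case (Suc i)
  have eq: "walk_ends E x (Suc i) = (\<Union>v\<in>walk_ends E x i. adj E `` {v})"
    by (auto simp: walk_ends_def)
  have fin: "finite (adj E `` {v})" for v
    using neighbours_subset[OF E] by (rule finite_subset) simp
  have D0: "0 \<le> D" using D[of 0] by linarith
  have "real (card (walk_ends E x (Suc i))) \<le> (\<Sum>v\<in>walk_ends E x i. real (card (adj E `` {v})))"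
    unfolding eq using Suc by (intro real_card_UN_le) blast
  also have "\<dots> \<le> real (card (walk_ends E x i)) * D"
    using D by (rule sum_bounded_above)
  also have "\<dots> \<le> D ^ i * D" using Suc D0 by (intro mult_right_mono) auto
  finally show ?case using Suc fin unfolding eq by (simp add: mult.commute)
qed (auto simp: walk_ends_def)

text \<open>There are at most \<open>D ^ (i + j)\<close> pairs for each choice of the two lengths, and for fixed \<open>i\<close>
  the sum over \<open>j\<close> is a piece of a geometric series dominated by its last term. The factor \<open>k + 1\<close>
  is the number of splittings \<open>i + j = k\<close>; it is the one in the final bound.\<close>

lemma card_covered_le:
  assumes E: "E \<subseteq> all_pairs n" and D: "\<And>x. real (card (adj E `` {x})) \<le> D" and "D > 1"
  shows "finite (covered E k x y) \<and>
    real (card (covered E k x y)) \<le> (real k + 1) * (D ^ (k + 1) / (D - 1))"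
proof -
  let ?S = "\<lambda>i j. (\<lambda>(u, v). {u, v}) ` (walk_ends E x i \<times> walk_ends E y j)"
  note S = card_walk_ends_le[OF E D]
  have fin: "finite (?S i j)" for i j using S by blast
  have c: "real (card (?S i j)) \<le> D ^ (i + j)" for i j
  proof -
    have "card (?S i j) \<le> card (walk_ends E x i \<times> walk_ends E y j)"
      using S by (intro card_image_le) auto
    also have "\<dots> = card (walk_ends E x i) * card (walk_ends E y j)" by (rule card_cartesian_product)
    finally have "real (card (?S i j)) \<le> real (card (walk_ends E x i)) * real (card (walk_ends E y j))"
      by (metis of_nat_mono of_nat_mult)
    also have "\<dots> \<le> D ^ i * D ^ j"
      using S \<open>D > 1\<close> by (intro mult_mono) auto
    finally show ?thesis by (simp add: power_add)
  qed
  have geo: "(\<Sum>s\<le>k. D ^ s) \<le> D ^ (k + 1) / (D - 1)"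
  proof -
    have "(\<Sum>s\<le>k. D ^ s) = (D ^ (k + 1) - 1) / (D - 1)"
      using \<open>D > 1\<close> geometric_sum[of D "Suc k"] by (simp add: lessThan_Suc_atMost)
    then show ?thesis using \<open>D > 1\<close> by (simp add: divide_right_mono)
  qed
  have inner: "real (card (\<Union>j\<le>k - i. ?S i j)) \<le> D ^ (k + 1) / (D - 1)" if "i \<le> k" for i
  proof -
    have "real (card (\<Union>j\<le>k - i. ?S i j)) \<le> (\<Sum>j\<le>k - i. real (card (?S i j)))"
      by (intro real_card_UN_le) simp
    also have "\<dots> \<le> (\<Sum>j\<le>k - i. D ^ (i + j))" by (intro sum_mono c)
    also have "\<dots> = (\<Sum>s\<in>(+) i ` {..k - i}. D ^ s)"
      by (subst sum.reindex) (auto simp: inj_on_def)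
    also have "\<dots> \<le> (\<Sum>s\<le>k. D ^ s)"
      using that \<open>D > 1\<close> by (intro sum_mono2) auto
    finally show ?thesis using geo by linarith
  qed
  have "real (card (covered E k x y)) \<le> (\<Sum>i\<le>k. real (card (\<Union>j\<le>k - i. ?S i j)))"
    unfolding covered_def by (intro real_card_UN_le) simp
  also have "\<dots> \<le> (\<Sum>i\<le>k. D ^ (k + 1) / (D - 1))" by (intro sum_mono inner) auto
  also have "\<dots> = (real k + 1) * (D ^ (k + 1) / (D - 1))" by simp
  finally have "real (card (covered E k x y)) \<le> (real k + 1) * (D ^ (k + 1) / (D - 1))" .
  moreover have "finite (covered E k x y)" unfolding covered_def using fin by blast
  ultimately show ?thesis by blast
qed

text \<open>Inserting a non-edge gives a different graph, which some query must detect; so the covered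
  sets of the queries together contain all non-edges.\<close>

lemma card_nonedges_le:
  assumes E: "E \<subseteq> all_pairs n" and Q: "Q \<subseteq> all_pairs n" "reconstructs n Q E"
    and D: "\<And>x. real (card (adj E `` {x})) \<le> D" "D > 1"
    and diam: "\<And>x y. x \<in> {1..n} \<Longrightarrow> y \<in> {1..n} \<Longrightarrow> x \<noteq> y \<Longrightarrow> graph_dist E x y \<le> enat (k + 2)"
  shows "real (card (all_pairs n - E)) \<le> real (card Q) * ((real k + 1) * (D ^ (k + 1) / (D - 1)))"
proof -
  \<comment> \<open>A query is unordered; \<open>Min\<close> and \<open>Max\<close> choose an order of its two vertices, and by symmetry the choice
    does not matter.\<close>
  define C where "C q = covered E k (Min q) (Max q)" for q
  have C: "C {x, y} = covered E k x y" for x y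
    by (cases "x \<le> y") (auto simp: C_def min_def max_def covered_commute)
  have "all_pairs n - E \<subseteq> (\<Union>q\<in>Q. C q)"
  proof
    fix e assume e: "e \<in> all_pairs n - E"
    then have "insert e E \<subseteq> all_pairs n" "insert e E \<noteq> E" using E by auto
    with Q(2) obtain x y where xy: "{x, y} \<in> Q" "graph_dist (insert e E) x y \<noteq> graph_dist E x y"
      unfolding reconstructs_def by metis
    obtain u v where uv: "e = {u, v}" using e by (auto elim: all_pairsE)
    have "{x, y} \<in> all_pairs n" using xy(1) Q(1) by blast
    then have "graph_dist E x y \<le> enat (k + 2)" by (intro diam) auto
    then have "e \<in> C {x, y}" using nonedge_covered[of u v E x y k] xy(2) uv C by auto
    then show "e \<in> (\<Union>q\<in>Q. C q)" using xy(1) by blast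
  qed
  moreover have finQ: "finite Q" using Q(1) by (rule finite_subset) simp
  note cov = card_covered_le[OF E D]
  moreover have "finite (\<Union>q\<in>Q. C q)" using finQ cov unfolding C_def by blast
  ultimately have "card (all_pairs n - E) \<le> card (\<Union>q\<in>Q. C q)"
    by (intro card_mono)
  then have "real (card (all_pairs n - E)) \<le> real (card (\<Union>q\<in>Q. C q))" by simp
  also have "\<dots> \<le> (\<Sum>q\<in>Q. real (card (C q)))" using finQ by (rule real_card_UN_le)
  also have "\<dots> \<le> real (card Q) * ((real k + 1) * (D ^ (k + 1) / (D - 1)))"
    using cov unfolding C_def by (intro sum_bounded_above) blast
  finally show ?thesis .
qed

lemma obtain_two:
  assumes "2 \<le> card W"
  obtains w w' where "w \<in> W" "w' \<in> W" "w \<noteq> w'"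
proof -
  obtain T where T: "T \<subseteq> W" "card T = 2" by (rule obtain_subset_with_card_n[OF assms])
  then obtain w w' where "T = {w, w'}" "w \<noteq> w'" unfolding card_2_iff by auto
  with T(1) show ?thesis by (intro that[of w w']) auto
qed

lemma graph_dist_eq_2:
  assumes "x \<noteq> y" "{x, y} \<notin> E" "{x, w} \<in> E" "{w, y} \<in> E"
  shows "graph_dist E x y = 2"
proof -
  have "(x, y) \<in> adj E ^^ 2" using assms by (auto simp: numeral_2_eq_2)
  then have "graph_dist E x y \<le> enat 2" using graph_dist_le_iff by blast
  moreover have "\<not> graph_dist E x y \<le> enat 1"
  proof
    assume "graph_dist E x y \<le> enat 1"
    then obtain i where "i \<le> 1" "(x, y) \<in> adj E ^^ i" unfolding graph_dist_le_iff by blast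
    moreover from this(1) have "i = 0 \<or> i = 1" by auto
    ultimately show False using assms by auto
  qed
  ultimately show ?thesis
    by (cases "graph_dist E x y") (auto simp: numeral_eq_enat)
qed

text \<open>If every two vertices have two common neighbours, then toggling one pair \<open>e\<close> destroys at most
  one of the two paths of length two, so it changes no distance other than that of \<open>e\<close> itself.
  Hence no query can be omitted.\<close>

lemma reconstructs_imp_all_pairs:
  assumes E: "E \<subseteq> all_pairs n" and Q: "reconstructs n Q E"
    and nb: "\<And>x y. x \<in> {1..n} \<Longrightarrow> y \<in> {1..n} \<Longrightarrow> x \<noteq> y \<Longrightarrow>
      2 \<le> card {w \<in> {1..n} - {x, y}. {x, w} \<in> E \<and> {w, y} \<in> E}"
    and Qs: "Q \<subseteq> all_pairs n"
  shows "Q = all_pairs n"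
proof (rule ccontr)
  assume "Q \<noteq> all_pairs n"
  then obtain e where e: "e \<in> all_pairs n" "e \<notin> Q" using Qs by blast
  define E' where "E' = (if e \<in> E then E - {e} else insert e E)"
  have E': "E' \<subseteq> all_pairs n" "E' \<noteq> E" and in': "\<And>f. f \<noteq> e \<Longrightarrow> f \<in> E' \<longleftrightarrow> f \<in> E"
    using e(1) E by (auto simp: E'_def)
  have "graph_dist E' x y = graph_dist E x y" if xyQ: "{x, y} \<in> Q" for x y
  proof -
    have xy: "x \<in> {1..n}" "y \<in> {1..n}" "x \<noteq> y" using xyQ Qs in_all_pairs by blast+
    have iff: "{x, y} \<in> E' \<longleftrightarrow> {x, y} \<in> E" using xyQ e(2) in' by metis
    show ?thesis
    proof (cases "{x, y} \<in> E")
      case True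
      then show ?thesis using xy(3) iff graph_dist_eq_1_iff by metis
    next
      case False
      let ?W = "{w \<in> {1..n} - {x, y}. {x, w} \<in> E \<and> {w, y} \<in> E}"
      from nb[OF xy] obtain w w' where w: "w \<in> ?W" "w' \<in> ?W" "w \<noteq> w'"
        by (rule obtain_two)
      \<comment> \<open>The two paths through \<open>w\<close> and \<open>w'\<close> share no edge, so one of them avoids \<open>e\<close>.\<close>
      have "\<not> (e \<in> {{x, w}, {w, y}} \<and> e \<in> {{x, w'}, {w', y}})"
        using w xy by (auto simp: doubleton_eq_iff)
      then obtain z where z: "z \<in> ?W" "e \<noteq> {x, z}" "e \<noteq> {z, y}" using w by blast
      then have "{x, z} \<in> E'" "{z, y} \<in> E'" using in' by auto
      then have "graph_dist E' x y = 2" using iff False xy by (intro graph_dist_eq_2) auto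
      moreover have "graph_dist E x y = 2" using z False xy by (intro graph_dist_eq_2) auto
      ultimately show ?thesis by simp
    qed
  qed
  then have "E' = E" using Q E' unfolding reconstructs_def by blast
  with E' show False by simp
qed

section \<open>Lower bounds on the query complexity\<close>

text \<open>Adaptivity gives no advantage here: the queries that an algorithm makes on the hidden graph form
  a reconstructing set, and the bounds hold for every such set.\<close>

lemma query_complexity_ge:
  assumes E: "E \<subseteq> all_pairs n"
    and Q: "\<And>Q. Q \<subseteq> all_pairs n \<Longrightarrow> reconstructs n Q E \<Longrightarrow> c \<le> real (card Q)"
  shows "c \<le> real (query_complexity n E)"
proof -
  obtain A t where A: "adaptive_algorithm n A" "length (run A E t) \<le> query_complexity n E"
    "reconstructs n (queried (run A E t)) E"
    using query_complexity_attained[OF E] unfolding reconstructible_by_def by blast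
  have "queried (run A E t) \<subseteq> all_pairs n"
  proof (induction t)
    case (Suc t)
    then show ?case
      using A(1) by (auto simp: queried_def adaptive_algorithm_def split: option.split)
  qed (simp add: queried_def)
  then have "c \<le> real (card (queried (run A E t)))" using A(3) Q by blast
  also have "card (queried (run A E t)) \<le> length (run A E t)"
    unfolding queried_def by (meson card_image_le card_length finite_set order_trans)
  finally show ?thesis using A(2) by linarith
qed

lemma adj_Image_eq:
  assumes "E \<subseteq> all_pairs n"
  shows "adj E `` {x} = (if x \<in> {1..n} then {v \<in> {1..n} - {x}. {x, v} \<in> E} else {})"
proof -
  have "v \<noteq> x \<and> v \<in> {1..n} \<and> x \<in> {1..n}" if "{x, v} \<in> E" for v
    using that assms in_all_pairs by blast
  moreover from this[of x] have "{x} \<notin> E" by auto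
  ultimately show ?thesis by auto
qed

lemma card_edges_le:
  assumes E: "E \<subseteq> all_pairs n" and D: "\<And>x. real (card (adj E `` {x})) \<le> D"
  shows "real (card E) \<le> real n * D"
proof -
  have "E \<subseteq> (\<Union>x\<in>{1..n}. (\<lambda>v. {x, v}) ` (adj E `` {x}))"
  proof
    fix e assume e: "e \<in> E"
    then obtain x y where "e = {x, y}" "x \<in> {1..n}" using E by (blast elim: all_pairsE)
    with e show "e \<in> (\<Union>x\<in>{1..n}. (\<lambda>v. {x, v}) ` (adj E `` {x}))"
      by (intro UN_I[of x] image_eqI[of _ _ y]) auto
  qed
  moreover have fin: "finite (adj E `` {x})" for x
    using neighbours_subset[OF E] by (rule finite_subset) simp
  ultimately have "real (card E) \<le> real (card (\<Union>x\<in>{1..n}. (\<lambda>v. {x, v}) ` (adj E `` {x})))"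
    by (intro of_nat_mono card_mono) auto
  also have "\<dots> \<le> (\<Sum>x\<in>{1..n}. real (card ((\<lambda>v. {x, v}) ` (adj E `` {x}))))"
    by (intro real_card_UN_le) simp
  also have "\<dots> \<le> (\<Sum>x\<in>{1..n}. D)"
  proof (intro sum_mono)
    fix x
    have "card ((\<lambda>v. {x, v}) ` (adj E `` {x})) \<le> card (adj E `` {x})"
      using fin by (rule card_image_le)
    with D[of x] show "real (card ((\<lambda>v. {x, v}) ` (adj E `` {x}))) \<le> D" by linarith
  qed
  finally show ?thesis by simp
qed

lemma query_bound_eq:
  assumes "0 < n"
  shows "1 / (2 * K * real n powi (int k - 2) * p ^ k) = ((real n)\<^sup>2 / 2) / ((real n * p) ^ k * K)"
proof -
  have "real n powi (int k - 2) = real n ^ k / (real n)\<^sup>2"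
    using assms by (simp add: power_int_diff)
  then have "2 * K * real n powi (int k - 2) * p ^ k = 2 * ((real n * p) ^ k * K) / (real n)\<^sup>2"
    by (simp add: power_mult_distrib)
  then show ?thesis by simp
qed

text \<open>When \<open>p\<close> is small almost all pairs are non-edges. The fourth condition on \<open>\<delta>\<close> collects the
  relative errors: the edges and the diagonal missing from \<open>n\<^sup>2 / 2\<close>, the lower terms of the geometric
  series, and the \<open>k\<close>-th power of the excess of the maximum degree over \<open>n * p\<close>.\<close>

lemma sparse_query_complexity_ge:
  fixes \<delta> \<epsilon> p :: real
  assumes E: "E \<subseteq> all_pairs n" and n: "0 < n" "1 / real n \<le> \<delta>" and p: "0 < p" "p \<le> \<delta>"
    and deg: "\<And>x. x \<in> {1..n} \<Longrightarrow> real (card {v \<in> {1..n} - {x}. {x, v} \<in> E}) \<le> (1 + \<delta>) * (real n * p)"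
    and diam: "\<And>x y. x \<in> {1..n} \<Longrightarrow> y \<in> {1..n} \<Longrightarrow> x \<noteq> y \<Longrightarrow> graph_dist E x y \<le> enat (k + 2)"
    and \<delta>: "\<delta> < 1" "1 / \<delta> \<le> real n * p" "0 \<le> 1 - \<delta> - 2 * (1 + \<delta>) * \<delta>"
      "(real k + 1) * (1 + \<delta>) ^ k \<le> (1 - \<delta> - 2 * (1 + \<delta>) * \<delta>) * (1 - \<delta>) * (real k + 1 + \<epsilon>)"
    and \<epsilon>: "\<epsilon> > 0"
  shows "1 / (2 * (real k + 1 + \<epsilon>) * real n powi (int k - 2) * p ^ k) \<le> real (query_complexity n E)"
proof (rule query_complexity_ge[OF E])
  fix Q assume Q: "Q \<subseteq> all_pairs n" "reconstructs n Q E"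
  define D where "D = (1 + \<delta>) * (real n * p)"
  have \<delta>0: "0 < \<delta>" using p by linarith
  have "1 < 1 / \<delta>" using \<delta>0 \<delta>(1) by simp
  also have le: "1 / \<delta> \<le> D"
    using \<delta>(2) \<delta>0 p n unfolding D_def by (simp add: algebra_simps add_increasing2)
  finally have D1: "1 < D" .
  have Dd: "\<delta> * D \<ge> 1" using le \<delta>0 by (simp add: field_simps)
  have D: "real (card (adj E `` {x})) \<le> D" for x
    using deg[of x] D1 unfolding adj_Image_eq[OF E] D_def by auto
  have "D / real n \<le> (1 + \<delta>) * \<delta>"
    using p n \<delta>0 by (simp add: D_def)
  then have "D \<le> (1 + \<delta>) * \<delta> * real n" using n by (simp add: field_simps)
  have "card (all_pairs n) \<le> card (all_pairs n - E) + card E"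
    using E by (simp add: card_Diff_subset finite_subset card_mono)
  then have "real (card (all_pairs n)) - real (card E) \<le> real (card (all_pairs n - E))" by linarith
  with card_edges_le[OF E D] have
    "real n * (real n - 1) / 2 - real n * D \<le> real (card (all_pairs n - E))"
    by (simp add: real_card_all_pairs)
  also have "\<dots> \<le> real (card Q) * ((real k + 1) * (D ^ (k + 1) / (D - 1)))"
    by (rule card_nonedges_le[OF E Q D D1 diam])
  finally have main: "real n * (real n - 1) / 2 - real n * D
    \<le> real (card Q) * ((real k + 1) * (D ^ (k + 1) / (D - 1)))" .
  let ?c = "1 - \<delta> - 2 * (1 + \<delta>) * \<delta>"
  have "(real n)\<^sup>2 / 2 * ?c \<le> real n * (real n - 1) / 2 - real n * D"
  proof -
    have "1 \<le> \<delta> * real n" using n by (simp add: field_simps)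
    then have "real n * 1 \<le> real n * (\<delta> * real n)" by (intro mult_left_mono) auto
    moreover have "real n * D \<le> real n * ((1 + \<delta>) * \<delta> * real n)"
      using \<open>D \<le> _\<close> by (intro mult_left_mono) auto
    ultimately show ?thesis by (simp add: algebra_simps power2_eq_square)
  qed
  also note main
  also have "D ^ (k + 1) / (D - 1) \<le> D ^ k / (1 - \<delta>)"
  proof -
    have "D * (1 - \<delta>) \<le> D - 1" using Dd by (simp add: algebra_simps)
    then have "D ^ k * (D * (1 - \<delta>)) \<le> D ^ k * (D - 1)" using D1 by (intro mult_left_mono) auto
    then show ?thesis using D1 \<delta>(1) by (simp add: divide_simps mult_ac)
  qed
  finally have "(real n)\<^sup>2 / 2 * ?c \<le> real (card Q) * ((real k + 1) * (D ^ k / (1 - \<delta>)))"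
    by (simp add: mult_left_mono)
  then have "(real n)\<^sup>2 / 2 * (?c * (1 - \<delta>)) \<le> real (card Q) * ((real k + 1) * D ^ k)"
    using \<delta>(1) by (simp add: field_simps)
  then have step: "(real n)\<^sup>2 / 2 * (?c * (1 - \<delta>)) * (real k + 1 + \<epsilon>)
      \<le> real (card Q) * ((real k + 1) * D ^ k) * (real k + 1 + \<epsilon>)"
    using \<epsilon> by (intro mult_right_mono) auto
  have "((real k + 1) * (1 + \<delta>) ^ k) * ((real n)\<^sup>2 / 2)
      \<le> (?c * (1 - \<delta>) * (real k + 1 + \<epsilon>)) * ((real n)\<^sup>2 / 2)"
    using \<delta>(4) by (intro mult_right_mono) auto
  also have "\<dots> = (real n)\<^sup>2 / 2 * (?c * (1 - \<delta>)) * (real k + 1 + \<epsilon>)" by (simp only: mult_ac)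
  also note step
  also have "real (card Q) * ((real k + 1) * D ^ k) * (real k + 1 + \<epsilon>)
      = ((real k + 1) * (1 + \<delta>) ^ k) * (real (card Q) * (real n * p) ^ k * (real k + 1 + \<epsilon>))"
    by (simp only: D_def power_mult_distrib mult_ac)
  finally have fin: "(real n)\<^sup>2 / 2 \<le> real (card Q) * (real n * p) ^ k * (real k + 1 + \<epsilon>)"
    using \<delta>0 by (subst (asm) mult_le_cancel_left_pos) (auto intro!: mult_pos_pos)
  have "1 / (2 * (real k + 1 + \<epsilon>) * real n powi (int k - 2) * p ^ k)
      = ((real n)\<^sup>2 / 2) / ((real n * p) ^ k * (real k + 1 + \<epsilon>))"
    using n(1) by (rule query_bound_eq)
  also have "\<dots> \<le> real (card Q)"
    using fin n p \<epsilon> by (subst pos_divide_le_eq) (auto simp: mult_ac intro!: mult_pos_pos)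
  finally show "1 / (2 * (real k + 1 + \<epsilon>) * real n powi (int k - 2) * p ^ k) \<le> real (card Q)" .
qed

lemma dense_query_complexity_ge:
  fixes \<epsilon> p :: real
  assumes E: "E \<subseteq> all_pairs n" and n: "2 \<le> n" and np: "1 \<le> real n * p" and k: "1 \<le> k" and \<epsilon>: "\<epsilon> > 0"
    and nb: "\<And>x y. x \<in> {1..n} \<Longrightarrow> y \<in> {1..n} \<Longrightarrow> x \<noteq> y \<Longrightarrow>
      2 \<le> card {w \<in> {1..n} - {x, y}. {x, w} \<in> E \<and> {w, y} \<in> E}"
  shows "1 / (2 * (real k + 1 + \<epsilon>) * real n powi (int k - 2) * p ^ k) \<le> real (query_complexity n E)"
proof (rule query_complexity_ge[OF E])
  fix Q assume Q: "Q \<subseteq> all_pairs n" "reconstructs n Q E"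
  have cQ: "real (card Q) = real n * (real n - 1) / 2"
    using reconstructs_imp_all_pairs[OF E Q(2) nb Q(1)] real_card_all_pairs by simp
  have "1 / (2 * (real k + 1 + \<epsilon>) * real n powi (int k - 2) * p ^ k)
      = ((real n)\<^sup>2 / 2) / ((real n * p) ^ k * (real k + 1 + \<epsilon>))"
    using n by (intro query_bound_eq) simp
  also have "\<dots> \<le> ((real n)\<^sup>2 / 2) / 2"
  proof (intro divide_left_mono)
    have "1 * 2 \<le> (real n * p) ^ k * (real k + 1 + \<epsilon>)"
      using np k \<epsilon> by (intro mult_mono one_le_power) auto
    then show "2 \<le> (real n * p) ^ k * (real k + 1 + \<epsilon>)" "0 < (real n * p) ^ k * (real k + 1 + \<epsilon>) * 2"
      by auto
  qed auto
  also have "\<dots> \<le> real n * (real n - 1) / 2"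
  proof -
    have "real n * 2 \<le> real n * real n" using n by (intro mult_left_mono) auto
    then show ?thesis by (simp add: power2_eq_square algebra_simps)
  qed
  finally show "1 / (2 * (real k + 1 + \<epsilon>) * real n powi (int k - 2) * p ^ k) \<le> real (card Q)"
    by (simp add: cQ)
qed

section \<open>Independent edges\<close>

lemma set_pmf_gnp: "G \<in> set_pmf (gnp n p) \<Longrightarrow> G \<subseteq> all_pairs n"
  by (auto simp: gnp_def)

lemma finite_set_pmf_gnp: "finite (set_pmf (gnp n p))"
  by (rule finite_subset[of _ "Pow (all_pairs n)"]) (auto dest: set_pmf_gnp)

text \<open>All probabilities below reduce to this one: the events of interest are decomposed into
  prescriptions of present and absent edges.\<close>

lemma prob_gnp_pattern:
  assumes p: "0 \<le> p" "p \<le> 1" and IJ: "I \<subseteq> all_pairs n" "J \<subseteq> all_pairs n" "I \<inter> J = {}"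
  shows "measure_pmf.prob (gnp n p) {G. I \<subseteq> G \<and> J \<inter> G = {}} = p ^ card I * (1 - p) ^ card J"
proof -
  let ?P = "Pi_pmf (all_pairs n) False (\<lambda>_. bernoulli_pmf p)"
  define B where "B e = (if e \<in> I then {True} else if e \<in> J then {False} else UNIV)" for e
  have "(\<lambda>f. {e \<in> all_pairs n. f e}) -` {G. I \<subseteq> G \<and> J \<inter> G = {}} = Pi (all_pairs n) B"
  proof (intro set_eqI iffI)
    fix f assume "f \<in> (\<lambda>f. {e \<in> all_pairs n. f e}) -` {G. I \<subseteq> G \<and> J \<inter> G = {}}"
    then show "f \<in> Pi (all_pairs n) B" by (auto simp: B_def)
  next
    fix f assume f: "f \<in> Pi (all_pairs n) B"
    have "f e" if "e \<in> I" for e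
      using Pi_mem[OF f, of e] that IJ(1) by (auto simp: B_def)
    moreover have "\<not> f e" if "e \<in> J" for e
    proof -
      have "e \<in> all_pairs n" "e \<notin> I" using that IJ by auto
      then show ?thesis using Pi_mem[OF f, of e] that by (simp add: B_def)
    qed
    ultimately show "f \<in> (\<lambda>f. {e \<in> all_pairs n. f e}) -` {G. I \<subseteq> G \<and> J \<inter> G = {}}"
      using IJ(1) by auto
  qed
  then have "measure_pmf.prob (gnp n p) {G. I \<subseteq> G \<and> J \<inter> G = {}}
      = measure_pmf.prob ?P (Pi (all_pairs n) B)"
    by (simp add: gnp_def)
  also have "\<dots> = (\<Prod>e\<in>all_pairs n. measure_pmf.prob (bernoulli_pmf p) (B e))"
    by (rule measure_Pi_pmf_Pi) simp
  also have "\<dots> = (\<Prod>e\<in>all_pairs n. (if e \<in> I then p else 1) * (if e \<in> J then 1 - p else 1))"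
    using p IJ(3) by (intro prod.cong) (auto simp: B_def measure_pmf_single)
  also have "\<dots> = p ^ card I * (1 - p) ^ card J"
    using IJ by (simp add: prod.distrib prod.If_cases Int_absorb1 Int_absorb2)
  finally show ?thesis .
qed

text \<open>The generating function of a binomial variable. It is enough that joint probabilities of the
  events factorise: expanding the product of the factors \<open>1 + (z - 1) * [S v]\<close> leaves only
  probabilities of intersections.\<close>

lemma expectation_power_count:
  fixes z r :: real
  assumes fin: "finite (set_pmf M)" "finite V"
    and r: "\<And>U. U \<subseteq> V \<Longrightarrow> measure_pmf.prob M {w. \<forall>v\<in>U. S v w} = r ^ card U"
  shows "measure_pmf.expectation M (\<lambda>w. z ^ card {v \<in> V. S v w}) = (1 + (z - 1) * r) ^ card V"
proof -
  have "z ^ card {v \<in> V. S v w}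
      = (\<Sum>U\<in>Pow V. (z - 1) ^ card U * indicator {w. \<forall>v\<in>U. S v w} w)" for w
  proof -
    have "z ^ card {v \<in> V. S v w} = (\<Prod>v\<in>V. if S v w then z else 1)"
      using fin by (simp add: prod.If_cases Int_def)
    also have "\<dots> = (\<Prod>v\<in>V. (z - 1) * of_bool (S v w) + 1)"
      by (intro prod.cong) auto
    also have "\<dots> = (\<Sum>U\<in>Pow V. (\<Prod>v\<in>U. (z - 1) * of_bool (S v w)))"
      using prod_add[OF fin(2), of "\<lambda>v. (z - 1) * of_bool (S v w)" "\<lambda>_. 1"] by simp
    also have "\<dots> = (\<Sum>U\<in>Pow V. (z - 1) ^ card U * indicator {w. \<forall>v\<in>U. S v w} w)"
    proof (intro sum.cong refl)
      fix U assume "U \<in> Pow V"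
      then have "finite U" using fin(2) finite_subset by blast
      then have "(\<Prod>v\<in>U. of_bool (S v w)) = (indicator {w. \<forall>v\<in>U. S v w} w :: real)"
        by (induction U rule: finite_induct) (auto simp: indicator_def)
      then show "(\<Prod>v\<in>U. (z - 1) * of_bool (S v w))
          = (z - 1) ^ card U * indicator {w. \<forall>v\<in>U. S v w} w"
        by (simp add: prod.distrib)
    qed
    finally show ?thesis .
  qed
  then have "measure_pmf.expectation M (\<lambda>w. z ^ card {v \<in> V. S v w})
      = measure_pmf.expectation M (\<lambda>w. \<Sum>U\<in>Pow V. (z - 1) ^ card U * indicator {w. \<forall>v\<in>U. S v w} w)"
    by simp
  also have "\<dots> = (\<Sum>U\<in>Pow V. (z - 1) ^ card U * measure_pmf.prob M {w. \<forall>v\<in>U. S v w})"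
    using fin(1) by (subst Bochner_Integration.integral_sum) (auto intro!: integrable_measure_pmf_finite)
  also have "\<dots> = (\<Sum>U\<in>Pow V. (\<Prod>v\<in>U. (z - 1) * r) * (\<Prod>v\<in>V - U. 1))"
    using r by (intro sum.cong) (auto simp: power_mult_distrib)
  also have "\<dots> = (\<Prod>v\<in>V. (z - 1) * r + 1)"
    using fin(2) by (subst prod_add) auto
  finally show ?thesis by (simp add: add.commute)
qed

text \<open>The Chernoff method. With \<open>z > 1\<close> it bounds the upper tail of the count, with \<open>z < 1\<close> the lower one.\<close>

lemma prob_count_le:
  fixes z r c :: real
  assumes fin: "finite (set_pmf M)" "finite V"
    and r: "\<And>U. U \<subseteq> V \<Longrightarrow> measure_pmf.prob M {w. \<forall>v\<in>U. S v w} = r ^ card U"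
    and z: "z \<ge> 0" and c: "c > 0" and le: "\<And>w. P w \<Longrightarrow> c \<le> z ^ card {v \<in> V. S v w}"
  shows "measure_pmf.prob M {w. P w} \<le> (1 + (z - 1) * r) ^ card V / c"
proof -
  have "measure_pmf.prob M {w. P w} \<le> measure_pmf.prob M {w \<in> space M. c \<le> z ^ card {v \<in> V. S v w}}"
    using le by (intro measure_pmf.finite_measure_mono) auto
  also have "\<dots> \<le> measure_pmf.expectation M (\<lambda>w. z ^ card {v \<in> V. S v w}) / c"
    using z c by (intro integral_Markov_inequality_measure)
      (auto intro!: integrable_measure_pmf_finite fin)
  finally show ?thesis using expectation_power_count[OF fin r, where z = z] by simp
qed

lemma one_plus_power_le_exp: "0 \<le> 1 + x \<Longrightarrow> (1 + x) ^ m \<le> exp (real m * x)" for x :: real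
  by (metis exp_ge_add_one_self exp_of_nat_mult power_mono)

lemma prob_edges:
  assumes "0 \<le> p" "p \<le> 1" "I \<subseteq> all_pairs n"
  shows "measure_pmf.prob (gnp n p) {G. I \<subseteq> G} = p ^ card I"
  using prob_gnp_pattern[of p I n "{}"] assms by simp

lemma prob_no_edges:
  assumes "0 \<le> p" "p \<le> 1" "J \<subseteq> all_pairs n"
  shows "measure_pmf.prob (gnp n p) {G. J \<inter> G = {}} = (1 - p) ^ card J"
  using prob_gnp_pattern[of p "{}" n J] assms by simp

lemma card_star: "x \<notin> U \<Longrightarrow> card ((\<lambda>v. {x, v}) ` U) = card U"
  by (intro card_image) (auto simp: inj_on_def doubleton_eq_iff)

lemma prob_degree_ge:
  assumes p: "0 \<le> p" "p \<le> 1" and \<delta>: "\<delta> > 0" and x: "x \<in> {1..n}"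
  shows "measure_pmf.prob (gnp n p) {G. (1 + \<delta>) * (real n * p) \<le> real (card {v \<in> {1..n} - {x}. {x, v} \<in> G})}
    \<le> exp (- ((1 + \<delta>) * ln (1 + \<delta>) - \<delta>) * (real n * p))"
proof -
  let ?V = "{1..n} - {x}"
  let ?m = "(1 + \<delta>) * (real n * p)"
  have "measure_pmf.prob (gnp n p) {G. ?m \<le> real (card {v \<in> ?V. {x, v} \<in> G})}
      \<le> (1 + ((1 + \<delta>) - 1) * p) ^ card ?V / exp (?m * ln (1 + \<delta>))"
  proof (rule prob_count_le)
    fix U assume U: "U \<subseteq> ?V"
    have "{G. \<forall>v\<in>U. {x, v} \<in> G} = {G. (\<lambda>v. {x, v}) ` U \<subseteq> G}" by auto
    moreover have "(\<lambda>v. {x, v}) ` U \<subseteq> all_pairs n" using U x by auto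
    moreover have "card ((\<lambda>v. {x, v}) ` U) = card U" using U by (intro card_star) auto
    ultimately show "measure_pmf.prob (gnp n p) {G. \<forall>v\<in>U. {x, v} \<in> G} = p ^ card U"
      using prob_edges[OF p] by metis
  next
    fix G assume "?m \<le> real (card {v \<in> ?V. {x, v} \<in> G})"
    then have "exp (?m * ln (1 + \<delta>)) \<le> exp (real (card {v \<in> ?V. {x, v} \<in> G}) * ln (1 + \<delta>))"
      using \<delta> by (simp add: mult_right_mono)
    also have "\<dots> = (1 + \<delta>) ^ card {v \<in> ?V. {x, v} \<in> G}"
      using \<delta> by (simp add: exp_of_nat_mult)
    finally show "exp (?m * ln (1 + \<delta>)) \<le> (1 + \<delta>) ^ card {v \<in> ?V. {x, v} \<in> G}" .
  qed (use \<delta> in \<open>auto simp: finite_set_pmf_gnp\<close>)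
  also have "\<dots> \<le> exp (real n * (\<delta> * p)) / exp (?m * ln (1 + \<delta>))"
  proof -
    have "(1 + ((1 + \<delta>) - 1) * p) ^ card ?V \<le> exp (real (card ?V) * (\<delta> * p))"
      using one_plus_power_le_exp[of "\<delta> * p" "card ?V"] \<delta> p by simp
    also have "\<dots> \<le> exp (real n * (\<delta> * p))"
      using \<delta> p x by (simp add: mult_right_mono)
    finally show ?thesis by (intro divide_right_mono) auto
  qed
  also have "\<dots> = exp (- ((1 + \<delta>) * ln (1 + \<delta>) - \<delta>) * (real n * p))"
    by (simp add: exp_diff[symmetric] algebra_simps)
  finally show ?thesis .
qed

lemma prob_few_common_neighbours:
  assumes p: "0 \<le> p" "p \<le> 1" and xy: "x \<in> {1..n}" "y \<in> {1..n}" "x \<noteq> y"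
  shows "measure_pmf.prob (gnp n p) {G. card {w \<in> {1..n} - {x, y}. {x, w} \<in> G \<and> {w, y} \<in> G} < 2}
    \<le> 2 * exp (- (p\<^sup>2 * (real n - 2) / 2))"
proof -
  let ?V = "{1..n} - {x, y}"
  have cV: "card ?V = n - 2" "2 \<le> n" 
    using xy card_mono[of "{1..n}" "{x, y}"] by (auto simp: card_Diff_subset)
  have half_le: "1 / 2 \<le> (1 / 2 :: real) ^ m" if "m < 2" for m :: nat
    using less_2_cases[OF that] by auto
  have "measure_pmf.prob (gnp n p) {G. card {w \<in> ?V. {x, w} \<in> G \<and> {w, y} \<in> G} < 2}
      \<le> (1 + (1 / 2 - 1) * p\<^sup>2) ^ card ?V / (1 / 2)"
  proof (rule prob_count_le)
    fix U assume U: "U \<subseteq> ?V"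
    let ?I = "(\<lambda>w. {x, w}) ` U \<union> (\<lambda>w. {y, w}) ` U"
    have "{G. \<forall>w\<in>U. {x, w} \<in> G \<and> {w, y} \<in> G} = {G. ?I \<subseteq> G}"
      by (auto simp: insert_commute)
    moreover have "?I \<subseteq> all_pairs n" using U xy by auto
    moreover have "card ?I = 2 * card U"
    proof -
      have "finite U" using U finite_subset by blast
      moreover have "(\<lambda>w. {x, w}) ` U \<inter> (\<lambda>w. {y, w}) ` U = {}"
        using U xy by (auto simp: doubleton_eq_iff)
      ultimately have "card ?I = card ((\<lambda>w. {x, w}) ` U) + card ((\<lambda>w. {y, w}) ` U)"
        by (intro card_Un_disjoint) auto
      moreover have "card ((\<lambda>w. {x, w}) ` U) = card U" "card ((\<lambda>w. {y, w}) ` U) = card U"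
        using U by (auto intro!: card_star)
      ultimately show ?thesis by simp
    qed
    ultimately show "measure_pmf.prob (gnp n p) {G. \<forall>w\<in>U. {x, w} \<in> G \<and> {w, y} \<in> G} = (p\<^sup>2) ^ card U"
      using prob_edges[OF p, of ?I n] by (simp only: power_mult)
  next
    fix G assume "card {w \<in> ?V. {x, w} \<in> G \<and> {w, y} \<in> G} < 2"
    then show "1 / 2 \<le> (1 / 2 :: real) ^ card {w \<in> ?V. {x, w} \<in> G \<and> {w, y} \<in> G}" by (rule half_le)
  qed (auto simp: finite_set_pmf_gnp)
  also have "\<dots> \<le> exp (real (card ?V) * (- (p\<^sup>2 / 2))) / (1 / 2)"
  proof -
    have "p\<^sup>2 \<le> 1" using p by (simp add: power_le_one)
    then show ?thesis using one_plus_power_le_exp[of "- (p\<^sup>2 / 2)" "card ?V"] by simp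
  qed
  also have "\<dots> = 2 * exp (- (p\<^sup>2 * (real n - 2) / 2))"
    using cV by (simp add: of_nat_diff mult.commute)
  finally show ?thesis .
qed

lemma prob_pair_union_le:
  fixes b :: real
  assumes b: "\<And>x y. x \<in> {1..n} \<Longrightarrow> y \<in> {1..n} \<Longrightarrow> x \<noteq> y \<Longrightarrow> measure_pmf.prob M {G. S x y G} \<le> b"
    and "0 \<le> b"
  shows "measure_pmf.prob M {G. \<exists>x\<in>{1..n}. \<exists>y\<in>{1..n}. x \<noteq> y \<and> S x y G} \<le> (real n)\<^sup>2 * b"
proof -
  define P where "P = {(x, y). x \<in> {1..n} \<and> y \<in> {1..n} \<and> x \<noteq> y}"
  have sub: "P \<subseteq> {1..n} \<times> {1..n}" by (auto simp: P_def)
  then have fin: "finite P" by (rule finite_subset) simp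
  have "{G. \<exists>x\<in>{1..n}. \<exists>y\<in>{1..n}. x \<noteq> y \<and> S x y G} \<subseteq> (\<Union>q\<in>P. {G. S (fst q) (snd q) G})"
  proof
    fix G assume "G \<in> {G. \<exists>x\<in>{1..n}. \<exists>y\<in>{1..n}. x \<noteq> y \<and> S x y G}"
    then obtain x y where "(x, y) \<in> P" "S x y G" unfolding P_def by blast
    then show "G \<in> (\<Union>q\<in>P. {G. S (fst q) (snd q) G})" by (intro UN_I[of "(x, y)"]) auto
  qed
  then have "measure_pmf.prob M {G. \<exists>x\<in>{1..n}. \<exists>y\<in>{1..n}. x \<noteq> y \<and> S x y G}
      \<le> measure_pmf.prob M (\<Union>q\<in>P. {G. S (fst q) (snd q) G})"
    by (intro measure_pmf.finite_measure_mono) auto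
  also have "\<dots> \<le> (\<Sum>q\<in>P. measure_pmf.prob M {G. S (fst q) (snd q) G})"
    using fin by (intro measure_pmf.finite_measure_subadditive_finite) auto
  also have "\<dots> \<le> real (card P) * b"
    using b by (intro sum_bounded_above) (auto simp: P_def)
  also have "\<dots> \<le> (real n)\<^sup>2 * b"
  proof (intro mult_right_mono)
    have "card P \<le> card ({1..n} \<times> {1..n})" using sub by (intro card_mono) auto
    then have "card P \<le> n\<^sup>2" by (simp add: card_cartesian_product power2_eq_square)
    then show "real (card P) \<le> (real n)\<^sup>2" by (metis of_nat_mono of_nat_power)
  qed fact
  finally show ?thesis .
qed

lemma prob_some_degree_large:
  assumes p: "0 \<le> p" "p \<le> 1" and \<delta>: "\<delta> > 0"
  shows "measure_pmf.prob (gnp n p)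
      {G. \<exists>x\<in>{1..n}. (1 + \<delta>) * (real n * p) \<le> real (card {v \<in> {1..n} - {x}. {x, v} \<in> G})}
    \<le> real n * exp (- ((1 + \<delta>) * ln (1 + \<delta>) - \<delta>) * (real n * p))"
proof -
  let ?F = "\<lambda>x. {G. (1 + \<delta>) * (real n * p) \<le> real (card {v \<in> {1..n} - {x}. {x, v} \<in> G})}"
  have "{G. \<exists>x\<in>{1..n}. (1 + \<delta>) * (real n * p) \<le> real (card {v \<in> {1..n} - {x}. {x, v} \<in> G})}
      = (\<Union>x\<in>{1..n}. ?F x)" by auto
  then have "measure_pmf.prob (gnp n p)
      {G. \<exists>x\<in>{1..n}. (1 + \<delta>) * (real n * p) \<le> real (card {v \<in> {1..n} - {x}. {x, v} \<in> G})}
      \<le> (\<Sum>x\<in>{1..n}. measure_pmf.prob (gnp n p) (?F x))"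
    using measure_pmf.finite_measure_subadditive_finite[of "{1..n}" ?F "gnp n p"] by simp
  also have "\<dots> \<le> real (card {1..n}) * exp (- ((1 + \<delta>) * ln (1 + \<delta>) - \<delta>) * (real n * p))"
    using prob_degree_ge[OF p \<delta>] by (intro sum_bounded_above) auto
  finally show ?thesis by simp
qed

section \<open>Expansion of small vertex sets\<close>

definition boundary :: "nat \<Rightarrow> nat set set \<Rightarrow> nat set \<Rightarrow> nat set" where
  "boundary n G A = {v \<in> {1..n} - A. \<exists>a\<in>A. {a, v} \<in> G}"

text \<open>A set \<open>A\<close> with \<open>card A * p\<close> small has few vertices adjacent to it twice, so its boundary
  should have nearly \<open>n * p * card A\<close> elements. Asking this of all such sets at once makes the growth
  of balls a deterministic consequence, with no conditioning on the earlier layers.\<close>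

definition expanding :: "nat \<Rightarrow> real \<Rightarrow> real \<Rightarrow> nat set set \<Rightarrow> bool" where
  "expanding n p \<eta> G \<longleftrightarrow> (\<forall>A. A \<subseteq> {1..n} \<and> A \<noteq> {} \<and> real (card A) * p \<le> \<eta> \<longrightarrow>
     (1 - 4 * \<eta>) * (real n * p) * real (card A) \<le> real (card (boundary n G A)))"

text \<open>The vertices outside \<open>A\<close> are adjacent to \<open>A\<close> independently, each with probability
  \<open>1 - (1 - p) ^ card A\<close>. The Chernoff method is applied to the vertices that are not adjacent to
  \<open>A\<close>, because for these the joint probabilities are powers of \<open>1 - p\<close>.\<close>

lemma prob_small_boundary:
  assumes p: "0 < p" "p \<le> 1" and np: "1 \<le> real n * p" and \<eta>: "0 < \<eta>" "\<eta> \<le> 1"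
    and A: "A \<subseteq> {1..n}" "A \<noteq> {}" "real (card A) * p \<le> \<eta>"
  shows "measure_pmf.prob (gnp n p)
      {G. real (card (boundary n G A)) < (1 - 4 * \<eta>) * (real n * p) * real (card A)}
    \<le> exp (- (\<eta>\<^sup>2 * (real n * p))) ^ card A"
proof -
  let ?V = "{1..n} - A"
  let ?a = "real (card A)"
  define M where "M = real n * p * ?a"
  define r where "r = (1 - p) ^ card A"
  have finA: "finite A" using A(1) finite_subset by blast
  have a1: "1 \<le> ?a" using A(2) finA by (simp add: Suc_leI card_gt_0_iff)
  have M0: "0 \<le> M" using p by (simp add: M_def)
  have cV: "real (card ?V) = real n - ?a"
    using A(1) finA card_mono[OF _ A(1)] by (simp add: card_Diff_subset of_nat_diff)
  have split: "card ?V = card (boundary n G A) + card {v \<in> ?V. \<not> (\<exists>a\<in>A. {a, v} \<in> G)}" for G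
    unfolding boundary_def by (subst card_Un_disjoint[symmetric]) (auto intro: arg_cong[where f = card])
  have "measure_pmf.prob (gnp n p) {G. real (card (boundary n G A)) < (1 - 4 * \<eta>) * M}
      \<le> (1 + ((1 + \<eta>) - 1) * r) ^ card ?V / ((1 + \<eta>) ^ card ?V * exp (- \<eta> * ((1 - 4 * \<eta>) * M)))"
  proof (rule prob_count_le[where S = "\<lambda>v G. \<not> (\<exists>a\<in>A. {a, v} \<in> G)"])
    fix U assume U: "U \<subseteq> ?V"
    let ?J = "(\<lambda>(a, v). {a, v}) ` (A \<times> U)"
    have "{G. \<forall>v\<in>U. \<not> (\<exists>a\<in>A. {a, v} \<in> G)} = {G. ?J \<inter> G = {}}" by auto
    moreover have "?J \<subseteq> all_pairs n"
    proof
      fix e assume "e \<in> ?J"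
      then obtain a v where e: "e = {a, v}" "a \<in> A" "v \<in> U" by auto
      have "a \<in> {1..n}" "v \<in> ?V" using e A(1) U by blast+
      with e show "e \<in> all_pairs n" by auto
    qed
    moreover have "card ?J = card A * card U"
      using U by (subst card_image) (auto simp: inj_on_def doubleton_eq_iff card_cartesian_product)
    ultimately show "measure_pmf.prob (gnp n p) {G. \<forall>v\<in>U. \<not> (\<exists>a\<in>A. {a, v} \<in> G)} = r ^ card U"
      using prob_no_edges[of p ?J n] p by (simp add: r_def power_mult)
  next
    fix G assume G: "real (card (boundary n G A)) < (1 - 4 * \<eta>) * M"
    let ?b = "card (boundary n G A)" and ?c = "card {v \<in> ?V. \<not> (\<exists>a\<in>A. {a, v} \<in> G)}"
    have "(1 + \<eta>) ^ ?b \<le> exp (real ?b * \<eta>)" using one_plus_power_le_exp \<eta> by simp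
    also have "\<dots> \<le> exp (\<eta> * ((1 - 4 * \<eta>) * M))"
      using G \<eta> by (simp add: mult.commute)
    finally have "(1 + \<eta>) ^ ?b / exp (\<eta> * ((1 - 4 * \<eta>) * M)) \<le> 1"
      by (simp only: divide_le_eq_1_pos exp_gt_zero)
    then have b: "(1 + \<eta>) ^ ?b * exp (- \<eta> * ((1 - 4 * \<eta>) * M)) \<le> 1"
      by (simp only: mult_minus_left exp_minus divide_inverse)
    have "(1 + \<eta>) ^ card ?V * exp (- \<eta> * ((1 - 4 * \<eta>) * M))
        = (1 + \<eta>) ^ ?c * ((1 + \<eta>) ^ ?b * exp (- \<eta> * ((1 - 4 * \<eta>) * M)))"
      unfolding split[of G] by (simp add: power_add mult_ac)
    also have "\<dots> \<le> (1 + \<eta>) ^ ?c * 1" using b \<eta> by (intro mult_left_mono) auto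
    finally show "(1 + \<eta>) ^ card ?V * exp (- \<eta> * ((1 - 4 * \<eta>) * M)) \<le> (1 + \<eta>) ^ ?c" by simp
  qed (use \<eta> in \<open>auto simp: finite_set_pmf_gnp\<close>)
  also have "\<dots> = (1 + (- \<eta> * (1 - r) / (1 + \<eta>))) ^ card ?V * exp (\<eta> * ((1 - 4 * \<eta>) * M))"
  proof -
    have "1 + (- \<eta> * (1 - r) / (1 + \<eta>)) = (1 + ((1 + \<eta>) - 1) * r) / (1 + \<eta>)"
      using \<eta> by (simp add: field_simps)
    moreover have "a / (b * exp (- \<eta> * X)) = a / b * exp (\<eta> * X)" for a b X
      by (simp only: mult_minus_left exp_minus divide_inverse inverse_mult_distrib inverse_inverse_eq mult.assoc)
    ultimately show ?thesis by (simp only: power_divide)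
  qed
  also have "\<dots> \<le> exp (- \<eta> * ((1 - 3 * \<eta>) * M)) * exp (\<eta> * ((1 - 4 * \<eta>) * M))"
  proof (intro mult_right_mono)
    have r01: "0 \<le> r" "r \<le> 1" using p by (auto simp: r_def power_le_one)
    have "r \<le> 1 / (1 + ?a * p)"
    proof -
      have "(1 - p) ^ card A * (1 + ?a * p) \<le> (1 - p) ^ card A * (1 + p) ^ card A"
        using p Bernoulli_inequality[of p "card A"] by (intro mult_left_mono) auto
      also have "\<dots> = (1 - p\<^sup>2) ^ card A"
        by (simp add: power_mult_distrib[symmetric] algebra_simps power2_eq_square)
      also have "\<dots> \<le> 1" using p by (intro power_le_one) (auto simp: power_le_one)
      moreover have "0 < 1 + ?a * p" using p by (simp add: add_pos_nonneg)
      ultimately show ?thesis by (simp add: r_def field_simps)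
    qed
    also have "1 / (1 + ?a * p) = 1 - ?a * p / (1 + ?a * p)"
    proof -
      have "0 < 1 + ?a * p" using p by (simp add: add_pos_nonneg)
      moreover have "1 / d = 1 - x / d" if "d = 1 + x" "0 < d" for d x :: real
        using that by (simp add: field_simps)
      ultimately show ?thesis by blast
    qed
    also have "\<dots> \<le> 1 - ?a * p / (1 + \<eta>)"
      using p A(3) \<eta> by (intro diff_left_mono divide_left_mono) (auto intro!: mult_pos_pos add_pos_nonneg)
    finally have q: "?a * p / (1 + \<eta>) \<le> 1 - r" by simp
    \<comment> \<open>Few vertices are lost to \<open>A\<close> itself, because \<open>n * p \<ge> 1\<close>.\<close>
    have "?a \<le> \<eta> * real n"
    proof -
      have "?a * 1 \<le> ?a * (real n * p)" using np by (intro mult_left_mono) auto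
      also have "\<dots> = (?a * p) * real n" by simp
      also have "\<dots> \<le> \<eta> * real n" using A(3) by (intro mult_right_mono) auto
      finally show ?thesis by simp
    qed
    then have V: "(1 - \<eta>) * real n \<le> real (card ?V)" unfolding cV by (simp add: algebra_simps)
    have "(1 - 3 * \<eta>) * M \<le> (1 - \<eta>) * M / (1 + \<eta>)\<^sup>2"
    proof -
      have "(1 - 3 * \<eta>) * (1 + \<eta>)\<^sup>2 = (1 - \<eta>) - \<eta>\<^sup>2 * (5 + 3 * \<eta>)"
        by (simp add: power2_eq_square algebra_simps)
      also have "\<dots> \<le> 1 - \<eta>" using \<eta> by simp
      finally have "(1 - 3 * \<eta>) * (1 + \<eta>)\<^sup>2 * M \<le> (1 - \<eta>) * M" using M0 by (rule mult_right_mono)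
      moreover have "0 < (1 + \<eta>)\<^sup>2" using \<eta> by simp
      ultimately show ?thesis by (simp add: pos_le_divide_eq mult_ac)
    qed
    also have "\<dots> = ((1 - \<eta>) * real n) * (?a * p / (1 + \<eta>)) / (1 + \<eta>)"
      by (simp add: M_def power2_eq_square field_simps)
    also have "\<dots> \<le> real (card ?V) * (1 - r) / (1 + \<eta>)"
      using V q \<eta> p r01 by (intro divide_right_mono mult_mono) auto
    finally have main: "(1 - 3 * \<eta>) * M \<le> real (card ?V) * (1 - r) / (1 + \<eta>)" .
    have "0 \<le> 1 + (- \<eta> * (1 - r) / (1 + \<eta>))"
      using r01 \<eta> by (simp add: field_simps)
    then have "(1 + (- \<eta> * (1 - r) / (1 + \<eta>))) ^ card ?V
        \<le> exp (real (card ?V) * (- \<eta> * (1 - r) / (1 + \<eta>)))"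
      by (rule one_plus_power_le_exp)
    also have "real (card ?V) * (- \<eta> * (1 - r) / (1 + \<eta>)) = - \<eta> * (real (card ?V) * (1 - r) / (1 + \<eta>))"
      by simp
    also have "exp \<dots> \<le> exp (- \<eta> * ((1 - 3 * \<eta>) * M))"
      using mult_left_mono[OF main, of \<eta>] \<eta> by simp
    finally show "(1 + (- \<eta> * (1 - r) / (1 + \<eta>))) ^ card ?V \<le> exp (- \<eta> * ((1 - 3 * \<eta>) * M))" .
  qed simp
  also have "\<dots> = exp (- (\<eta>\<^sup>2 * (real n * p))) ^ card A"
    by (simp add: exp_add[symmetric] exp_of_nat_mult[symmetric] M_def algebra_simps power2_eq_square)
  finally show ?thesis by (simp add: M_def mult.assoc)
qed

text \<open>The failure probability of one set decays geometrically in its size, which pays for the union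
  bound over all sets: the sum of \<open>r ^ card A\<close> over all \<open>A\<close> is \<open>(1 + r) ^ n\<close>.\<close>

lemma prob_not_expanding:
  assumes p: "0 < p" "p \<le> 1" and np: "1 \<le> real n * p" and \<eta>: "0 < \<eta>" "\<eta> \<le> 1"
  shows "measure_pmf.prob (gnp n p) {G. \<not> expanding n p \<eta> G}
    \<le> exp (real n * exp (- (\<eta>\<^sup>2 * (real n * p)))) - 1"
proof -
  let ?r = "exp (- (\<eta>\<^sup>2 * (real n * p)))"
  define I where "I = {A. A \<subseteq> {1..n} \<and> A \<noteq> {} \<and> real (card A) * p \<le> \<eta>}"
  define F where "F A = {G. real (card (boundary n G A)) < (1 - 4 * \<eta>) * (real n * p) * real (card A)}" for A
  have finI: "finite I" unfolding I_def by simp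
  have "{G. \<not> expanding n p \<eta> G} = (\<Union>A\<in>I. F A)"
    by (auto simp: expanding_def I_def F_def not_le)
  then have "measure_pmf.prob (gnp n p) {G. \<not> expanding n p \<eta> G}
      \<le> (\<Sum>A\<in>I. measure_pmf.prob (gnp n p) (F A))"
    using measure_pmf.finite_measure_subadditive_finite[OF finI] by simp
  also have "\<dots> \<le> (\<Sum>A\<in>I. ?r ^ card A)"
    unfolding F_def using prob_small_boundary[OF p np \<eta>] by (intro sum_mono) (auto simp: I_def)
  also have "\<dots> \<le> (\<Sum>A\<in>Pow {1..n} - {{}}. ?r ^ card A)"
    by (intro sum_mono2) (auto simp: I_def)
  also have "\<dots> = (\<Sum>A\<in>Pow {1..n}. ?r ^ card A) - 1"
    by (subst sum_diff) auto
  also have "(\<Sum>A\<in>Pow {1..n}. ?r ^ card A) = (\<Sum>A\<in>Pow {1..n}. (\<Prod>v\<in>A. ?r) * (\<Prod>v\<in>{1..n} - A. 1))"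
    by simp
  also have "\<dots> = (\<Prod>v\<in>{1..n}. ?r + 1)"
    by (subst prod_add) auto
  also have "\<dots> = (1 + ?r) ^ n" by (simp add: add.commute)
  also have "\<dots> \<le> exp (real n * ?r)" by (rule one_plus_power_le_exp) (simp add: add_nonneg_nonneg)
  finally show ?thesis by simp
qed

section \<open>Diameter at most k + 2\<close>

definition ball_of :: "nat set set \<Rightarrow> nat \<Rightarrow> nat \<Rightarrow> nat set" where
  "ball_of G x i = {v. \<exists>m\<le>i. (x, v) \<in> adj G ^^ m}"

definition delete_vertex :: "nat \<Rightarrow> nat set set \<Rightarrow> nat set set" where
  "delete_vertex y G = {e \<in> G. y \<notin> e}"

lemma ball_of_subset:
  assumes "H \<subseteq> all_pairs n" "\<And>e. e \<in> H \<Longrightarrow> y \<notin> e" "x \<in> {1..n} - {y}"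
  shows "ball_of H x i \<subseteq> {1..n} - {y}"
proof -
  have "v \<in> {1..n} - {y}" if "(x, v) \<in> adj H ^^ m" for v m
    using that
  proof (cases m)
    case (Suc l)
    then obtain z where "{z, v} \<in> H" using \<open>(x, v) \<in> adj H ^^ m\<close> by auto
    then show ?thesis using assms(1,2) in_all_pairs by blast
  qed (use assms(3) in auto)
  then show ?thesis unfolding ball_of_def by blast
qed

lemma boundary_subset_ball:
  assumes "A \<subseteq> ball_of H x i"
  shows "boundary n H A \<subseteq> ball_of H x (Suc i)"
proof
  fix v assume "v \<in> boundary n H A"
  then obtain a where "a \<in> A" "{a, v} \<in> H" unfolding boundary_def by blast
  moreover from this(1) obtain m where "m \<le> i" "(x, a) \<in> adj H ^^ m"
    using assms unfolding ball_of_def by blast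
  ultimately have "Suc m \<le> Suc i" "(x, v) \<in> adj H ^^ Suc m" by auto
  then show "v \<in> ball_of H x (Suc i)" unfolding ball_of_def by blast
qed

text \<open>Each layer multiplies the size of the ball by \<open>(1 - 5 * \<eta>) * n * p\<close>. Once the ball has \<open>c\<close>
  elements, only a subset of \<open>c\<close> of them is expanded, since larger sets need not expand; this yields the
  second argument of the minimum. Deleting \<open>y\<close> costs one boundary vertex, which the passage from
  \<open>4 * \<eta>\<close> to \<open>5 * \<eta>\<close> absorbs.\<close>

lemma card_ball_ge:
  assumes G: "G \<subseteq> all_pairs n" "expanding n p \<eta> G"
    and p: "0 < p" and \<eta>: "1 \<le> \<eta> * (real n * p)"
    and g: "1 \<le> (1 - 5 * \<eta>) * (real n * p)"
    and x: "x \<in> {1..n}" "x \<noteq> y"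
    and c: "1 \<le> c" "real c * p \<le> \<eta>"
  shows "min (((1 - 5 * \<eta>) * (real n * p)) ^ i) ((1 - 5 * \<eta>) * (real n * p) * real c)
    \<le> real (card (ball_of (delete_vertex y G) x i))"
proof (induction i)
  let ?H = "delete_vertex y G"
  let ?g = "(1 - 5 * \<eta>) * (real n * p)"
  have sub: "ball_of ?H x i \<subseteq> {1..n} - {y}" for i
    using G(1) x by (intro ball_of_subset) (auto simp: delete_vertex_def)
  have fin: "finite (ball_of ?H x i)" for i using sub by (rule finite_subset) simp
  {
    case 0
    have "ball_of ?H x 0 = {x}" by (auto simp: ball_of_def)
    then show ?case by simp
  next
    case (Suc i)
    obtain A where A: "A \<subseteq> ball_of ?H x i" "card A = min (card (ball_of ?H x i)) c"
      by (rule obtain_subset_with_card_n[OF min.cobounded1])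
    have "x \<in> ball_of ?H x i" unfolding ball_of_def by (auto intro!: exI[of _ 0])
    then have A1: "1 \<le> card A" using A(2) c fin[of i] by (auto simp: Suc_le_eq card_gt_0_iff)
    have An: "A \<subseteq> {1..n} - {y}" using A(1) sub by blast
    have "real (card A) * p \<le> real c * p" using A(2) p by (intro mult_right_mono) auto
    then have "real (card A) * p \<le> \<eta>" using c by linarith
    moreover have "A \<subseteq> {1..n}" "A \<noteq> {}" using An A1 by auto
    ultimately have exp: "(1 - 4 * \<eta>) * (real n * p) * real (card A) \<le> real (card (boundary n G A))"
      using G(2) unfolding expanding_def by blast
    have "boundary n G A \<subseteq> insert y (boundary n ?H A)"
      using An by (auto simp: boundary_def delete_vertex_def)
    moreover have finb: "finite (boundary n ?H A)" by (simp add: boundary_def)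
    ultimately have "card (boundary n G A) \<le> card (insert y (boundary n ?H A))"
      by (intro card_mono) auto
    also have "\<dots> \<le> Suc (card (boundary n ?H A))" using finb by (simp add: card_insert_if)
    also have "card (boundary n ?H A) \<le> card (ball_of ?H x (Suc i))"
      using boundary_subset_ball[OF A(1)] fin by (intro card_mono) auto
    finally have "real (card (boundary n G A)) \<le> real (card (ball_of ?H x (Suc i))) + 1" by simp
    moreover have "1 * 1 \<le> (\<eta> * (real n * p)) * real (card A)"
      using \<eta> A1 by (intro mult_mono) auto
    ultimately have step: "?g * real (card A) \<le> real (card (ball_of ?H x (Suc i)))"
      using exp by (simp add: algebra_simps)
    have "1 * real c \<le> ?g * real c" using g by (intro mult_right_mono) auto
    then have "min (?g ^ i) (real c) \<le> real (card A)"
      using Suc A(2) by (auto simp: min_def split: if_splits)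
    then have "?g * min (?g ^ i) (real c) \<le> ?g * real (card A)"
      using g by (intro mult_left_mono) auto
    with step have "?g * min (?g ^ i) (real c) \<le> real (card (ball_of ?H x (Suc i)))" by linarith
    moreover have "min (?g ^ Suc i) (?g * real c) = ?g * min (?g ^ i) (real c)"
      using g by (simp add: min_mult_distrib_left)
    ultimately show ?case by simp
  }
qed

text \<open>A set that is determined by the graph without \<open>y\<close> is independent of the edges at \<open>y\<close>, so it
  avoids the neighbours of \<open>y\<close> with probability \<open>(1 - p)\<close> to the power of its size. The proof sums
  over all possible graphs \<open>H\<close> on the other vertices.\<close>

lemma prob_no_edge_to_explored:
  assumes p: "0 \<le> p" "p \<le> 1" and y: "y \<in> {1..n}"
    and B: "\<And>H. H \<subseteq> all_pairs n \<Longrightarrow> (\<And>e. e \<in> H \<Longrightarrow> y \<notin> e) \<Longrightarrow> B H \<subseteq> {1..n} - {y}"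
  shows "measure_pmf.prob (gnp n p)
      {G. s \<le> real (card (B (delete_vertex y G))) \<and> (\<forall>b\<in>B (delete_vertex y G). {y, b} \<notin> G)}
    \<le> exp (- (p * s))"
proof -
  define R where "R = {e \<in> all_pairs n. y \<notin> e}"
  \<comment> \<open>\<open>H\<close> ranges over the possible graphs on the vertices other than \<open>y\<close> in which the set is large;
    \<open>F H\<close> prescribes that graph and forbids all edges from \<open>y\<close> to the set.\<close>
  define I where "I = {H \<in> Pow R. s \<le> real (card (B H))}"
  let ?J = "\<lambda>H. (R - H) \<union> (\<lambda>b. {y, b}) ` B H"
  define F where "F H = {G. H \<subseteq> G \<and> ?J H \<inter> G = {}}" for H
  have finR: "finite R" by (simp add: R_def)
  then have finI: "finite I" by (simp add: I_def)
  have BR: "B H \<subseteq> {1..n} - {y}" if "H \<subseteq> R" for H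
    using that by (intro B) (auto simp: R_def)
  have "measure_pmf.prob (gnp n p)
      {G. s \<le> real (card (B (delete_vertex y G))) \<and> (\<forall>b\<in>B (delete_vertex y G). {y, b} \<notin> G)}
    \<le> measure_pmf.prob (gnp n p) (\<Union>H\<in>I. F H)"
  proof (intro measure_pmf.finite_measure_mono_AE AE_pmfI impI)
    fix G assume G: "G \<in> set_pmf (gnp n p)"
      "G \<in> {G. s \<le> real (card (B (delete_vertex y G))) \<and> (\<forall>b\<in>B (delete_vertex y G). {y, b} \<notin> G)}"
    from set_pmf_gnp[OF G(1)] have "delete_vertex y G \<in> I"
      using G(2) by (auto simp: I_def R_def delete_vertex_def)
    moreover have "G \<in> F (delete_vertex y G)"
      using G(2) by (auto simp: F_def R_def delete_vertex_def)
    ultimately show "G \<in> (\<Union>H\<in>I. F H)" by blast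
  qed simp
  also have "\<dots> \<le> (\<Sum>H\<in>I. measure_pmf.prob (gnp n p) (F H))"
    using finI by (intro measure_pmf.finite_measure_subadditive_finite) auto
  also have "\<dots> \<le> (\<Sum>H\<in>I. exp (- (p * s)) * (p ^ card H * (1 - p) ^ card (R - H)))"
  proof (intro sum_mono)
    fix H assume "H \<in> I"
    then have H: "H \<subseteq> R" "s \<le> real (card (B H))" by (auto simp: I_def)
    have fins: "finite (B H)" using BR[OF H(1)] by (rule finite_subset) simp
    have "card (?J H) = card (R - H) + card ((\<lambda>b. {y, b}) ` B H)"
      using finR fins by (intro card_Un_disjoint) (auto simp: R_def)
    also have "card ((\<lambda>b. {y, b}) ` B H) = card (B H)"
      using BR[OF H(1)] by (intro card_star) auto
    finally have cJ: "card (?J H) = card (R - H) + card (B H)" .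
    have "measure_pmf.prob (gnp n p) (F H) = p ^ card H * (1 - p) ^ card (?J H)"
      unfolding F_def using H(1) BR[OF H(1)] y
      by (intro prob_gnp_pattern p) (auto simp: R_def)
    also have "\<dots> = (1 - p) ^ card (B H) * (p ^ card H * (1 - p) ^ card (R - H))"
      by (simp add: cJ power_add)
    also have "\<dots> \<le> exp (- (p * s)) * (p ^ card H * (1 - p) ^ card (R - H))"
    proof (intro mult_right_mono)
      have "(1 - p) ^ card (B H) \<le> exp (real (card (B H)) * - p)"
        using one_plus_power_le_exp[of "- p"] p by simp
      also have "\<dots> \<le> exp (- (p * s))" using mult_left_mono[OF H(2) p(1)] by (simp add: mult.commute)
      finally show "(1 - p) ^ card (B H) \<le> exp (- (p * s))" .
    qed (use p in auto)
    finally show "measure_pmf.prob (gnp n p) (F H) \<le> exp (- (p * s)) * (p ^ card H * (1 - p) ^ card (R - H))" .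
  qed
  also have "\<dots> \<le> (\<Sum>H\<in>Pow R. exp (- (p * s)) * (p ^ card H * (1 - p) ^ card (R - H)))"
    using p finR by (intro sum_mono2) (auto simp: I_def)
  also have "\<dots> = exp (- (p * s)) * (\<Sum>H\<in>Pow R. (\<Prod>e\<in>H. p) * (\<Prod>e\<in>R - H. 1 - p))"
    by (simp add: sum_distrib_left)
  also have "\<dots> = exp (- (p * s)) * (\<Prod>e\<in>R. p + (1 - p))"
    using prod_add[OF finR, of "\<lambda>_. p" "\<lambda>_. 1 - p"] by simp
  also have "\<dots> = exp (- (p * s))" by simp
  finally show ?thesis .
qed

text \<open>The ball of radius \<open>k + 1\<close> around \<open>x\<close> is explored without using \<open>y\<close>; an edge from \<open>y\<close> to it
  closes a walk of length at most \<open>k + 2\<close>.\<close>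

lemma prob_far_apart:
  assumes p: "0 < p" "p \<le> 1" and \<eta>: "1 \<le> \<eta> * (real n * p)"
    and g: "1 \<le> (1 - 5 * \<eta>) * (real n * p)"
    and xy: "x \<in> {1..n}" "y \<in> {1..n}" "x \<noteq> y"
    and c: "1 \<le> c" "real c * p \<le> \<eta>"
  shows "measure_pmf.prob (gnp n p) {G. expanding n p \<eta> G \<and> \<not> graph_dist G x y \<le> enat (k + 2)}
    \<le> exp (- (p * min (((1 - 5 * \<eta>) * (real n * p)) ^ (k + 1)) ((1 - 5 * \<eta>) * (real n * p) * real c)))"
    (is "_ \<le> exp (- (p * ?s))")
proof -
  let ?B = "\<lambda>H. ball_of H x (k + 1)"
  have "measure_pmf.prob (gnp n p) {G. expanding n p \<eta> G \<and> \<not> graph_dist G x y \<le> enat (k + 2)}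
    \<le> measure_pmf.prob (gnp n p)
      {G. ?s \<le> real (card (?B (delete_vertex y G))) \<and> (\<forall>b\<in>?B (delete_vertex y G). {y, b} \<notin> G)}"
  proof (intro measure_pmf.finite_measure_mono_AE AE_pmfI impI CollectI conjI ballI notI)
    fix G assume "G \<in> set_pmf (gnp n p)" and
      G: "G \<in> {G. expanding n p \<eta> G \<and> \<not> graph_dist G x y \<le> enat (k + 2)}"
    then have sub: "G \<subseteq> all_pairs n" by (intro set_pmf_gnp)
    show "?s \<le> real (card (?B (delete_vertex y G)))"
      using G xy by (intro card_ball_ge[OF sub _ p(1) \<eta> g _ _ c]) auto
    fix b assume b: "b \<in> ?B (delete_vertex y G)" "{y, b} \<in> G"
    then obtain m where "m \<le> k + 1" "(x, b) \<in> adj (delete_vertex y G) ^^ m"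
      unfolding ball_of_def by blast
    moreover from this(2) have "(x, b) \<in> adj G ^^ m"
      by (rule walk_mono) (auto simp: delete_vertex_def)
    ultimately have "Suc m \<le> k + 2" "(x, y) \<in> adj G ^^ Suc m"
      using b(2) by (auto simp: insert_commute)
    then show False using G unfolding graph_dist_le_iff by blast
  qed simp
  also have "\<dots> \<le> exp (- (p * ?s))"
    using p xy by (intro prob_no_edge_to_explored ball_of_subset) auto
  finally show ?thesis .
qed

text \<open>The exponent is \<open>p\<close> times the size of the ball of radius \<open>k + 1\<close>: either the ball has grown
  freely and the exponent is nearly \<open>n ^ (k + 1) * p ^ (k + 2)\<close>, or it has reached the size \<open>\<eta> / p\<close>
  earlier and has been multiplied once more.\<close>

lemma prob_diameter_large:
  assumes p: "0 < p" "p \<le> \<eta>" and \<eta>: "\<eta> \<le> 1 / 10" and \<eta>np: "1 \<le> \<eta> * (real n * p)"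
    and g: "2 \<le> real n * p"
  shows "measure_pmf.prob (gnp n p)
      {G. \<exists>x\<in>{1..n}. \<exists>y\<in>{1..n}. x \<noteq> y \<and> expanding n p \<eta> G \<and> \<not> graph_dist G x y \<le> enat (k + 2)}
    \<le> (real n)\<^sup>2 * (exp (- ((1 - 5 * \<eta>) ^ (k + 1) * (real n ^ (k + 1) * p ^ (k + 2))))
                  + exp (- ((1 - 5 * \<eta>) * \<eta> / 2 * (real n * p))))"
proof (rule prob_pair_union_le)
  fix x y assume xy: "x \<in> {1..n}" "y \<in> {1..n}" "x \<noteq> y"
  \<comment> \<open>The largest size at which expansion is still guaranteed; rounding costs at most a factor 2,
    since \<open>\<eta> / p \<ge> 1\<close>.\<close>
  define c where "c = nat \<lfloor>\<eta> / p\<rfloor>"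
  let ?g = "(1 - 5 * \<eta>) * (real n * p)"
  have one: "1 \<le> \<eta> / p" using p by (simp add: field_simps)
  then have c1: "1 \<le> c" by (simp add: c_def le_nat_iff le_floor_iff)
  have fl: "real c \<le> \<eta> / p" "\<eta> / p < real c + 1" using one by (auto simp: c_def)
  have cp: "real c * p \<le> \<eta>" using fl(1) p by (simp add: field_simps)
  have "\<eta> / p \<le> 2 * real c" using fl(2) c1 by linarith
  then have cl: "\<eta> / 2 \<le> p * real c" using p by (simp add: field_simps)
  have half: "1 / 2 \<le> 1 - 5 * \<eta>" using \<eta> by simp
  then have "1 / 2 * 2 \<le> ?g" using g by (intro mult_mono) auto
  then have g1: "1 \<le> ?g" by simp
  have p1: "p \<le> 1" using p \<eta> by simp
  have "measure_pmf.prob (gnp n p) {G. expanding n p \<eta> G \<and> \<not> graph_dist G x y \<le> enat (k + 2)}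
    \<le> exp (- (p * min (?g ^ (k + 1)) (?g * real c)))"
    by (rule prob_far_apart[OF p(1) p1 \<eta>np g1 xy c1 cp])
  also have "\<dots> \<le> exp (- (p * ?g ^ (k + 1))) + exp (- (p * (?g * real c)))"
    by (cases "?g ^ (k + 1) \<le> ?g * real c") (auto simp: min_def add_increasing add_increasing2)
  also have "p * ?g ^ (k + 1) = (1 - 5 * \<eta>) ^ (k + 1) * (real n ^ (k + 1) * p ^ (k + 2))"
    by (simp add: power_mult_distrib mult_ac)
  also have "exp (- (p * (?g * real c))) \<le> exp (- ((1 - 5 * \<eta>) * \<eta> / 2 * (real n * p)))"
  proof -
    have "?g * (\<eta> / 2) \<le> ?g * (p * real c)" using cl g1 by (intro mult_left_mono) auto
    then show ?thesis by (simp add: mult_ac)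
  qed
  finally show "measure_pmf.prob (gnp n p) {G. expanding n p \<eta> G \<and> \<not> graph_dist G x y \<le> enat (k + 2)}
    \<le> exp (- ((1 - 5 * \<eta>) ^ (k + 1) * (real n ^ (k + 1) * p ^ (k + 2))))
      + exp (- ((1 - 5 * \<eta>) * \<eta> / 2 * (real n * p)))" by simp
qed simp

section \<open>The random graph\<close>

lemma exists_small_delta:
  fixes \<epsilon> :: real
  assumes "\<epsilon> > 0"
  obtains \<delta> where "0 < \<delta>" "\<delta> < 1" "0 \<le> 1 - \<delta> - 2 * (1 + \<delta>) * \<delta>"
    "(real k + 1) * (1 + \<delta>) ^ k \<le> (1 - \<delta> - 2 * (1 + \<delta>) * \<delta>) * (1 - \<delta>) * (real k + 1 + \<epsilon>)"
proof -
  have "((\<lambda>\<delta>. (1 - \<delta> - 2 * (1 + \<delta>) * \<delta>) * (1 - \<delta>) * (real k + 1 + \<epsilon>) - (real k + 1) * (1 + \<delta>) ^ k)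
      \<longlongrightarrow> (1 - 0 - 2 * (1 + 0) * 0) * (1 - 0) * (real k + 1 + \<epsilon>) - (real k + 1) * (1 + 0) ^ k) (at_right 0)"
    by (intro tendsto_intros)
  then have 1: "\<forall>\<^sub>F \<delta> in at_right 0.
      0 < (1 - \<delta> - 2 * (1 + \<delta>) * \<delta>) * (1 - \<delta>) * (real k + 1 + \<epsilon>) - (real k + 1) * (1 + \<delta>) ^ k"
    using assms by (intro order_tendstoD) auto
  have "((\<lambda>\<delta>::real. 1 - \<delta> - 2 * (1 + \<delta>) * \<delta>) \<longlongrightarrow> 1 - 0 - 2 * (1 + 0) * 0) (at_right 0)"
    by (intro tendsto_intros)
  then have 2: "\<forall>\<^sub>F \<delta>::real in at_right 0. 0 < 1 - \<delta> - 2 * (1 + \<delta>) * \<delta>"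
    by (intro order_tendstoD) auto
  have 3: "\<forall>\<^sub>F \<delta>::real in at_right 0. \<delta> \<in> {0<..<1}"
    by (rule eventually_at_right_real) simp
  have "\<forall>\<^sub>F \<delta> in at_right 0. 0 < \<delta> \<and> \<delta> < 1 \<and> 0 \<le> 1 - \<delta> - 2 * (1 + \<delta>) * \<delta> \<and>
    (real k + 1) * (1 + \<delta>) ^ k \<le> (1 - \<delta> - 2 * (1 + \<delta>) * \<delta>) * (1 - \<delta>) * (real k + 1 + \<epsilon>)"
    using 1 2 3 by eventually_elim auto
  from eventually_happens'[OF trivial_limit_at_right_real this] show ?thesis using that by blast
qed

lemma degree_exponent_pos:
  assumes "\<delta> > 0"
  shows "0 < (1 + \<delta>) * ln (1 + \<delta>) - (\<delta>::real)"
proof -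
  have "ln (1 / (1 + \<delta>)) < 1 / (1 + \<delta>) - 1"
    using assms ln_le_minus_one[of "1 / (1 + \<delta>)"] ln_eq_minus_one[of "1 / (1 + \<delta>)"]
    by (force simp: less_le)
  then show ?thesis using assms by (simp add: ln_div field_simps)
qed

lemma prob_ge_one_minus:
  assumes "\<And>G. G \<in> set_pmf M \<Longrightarrow> G \<notin> B \<Longrightarrow> G \<in> S" and "measure_pmf.prob M B \<le> b"
  shows "1 - b \<le> measure_pmf.prob M S"
proof -
  have "1 = measure_pmf.prob M UNIV" by simp
  also have "\<dots> \<le> measure_pmf.prob M (S \<union> B)"
    using assms(1) by (intro measure_pmf.finite_measure_mono_AE AE_pmfI) auto
  also have "\<dots> \<le> measure_pmf.prob M S + measure_pmf.prob M B"
    by (intro measure_Un_le) auto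
  finally show ?thesis using assms(2) by linarith
qed

text \<open>The dichotomy at \<open>p \<le> \<eta>\<close> is what lets \<open>p\<close> be arbitrary: above the threshold two vertices have
  many common neighbours, below it the graph is sparse enough for counting non-edges. The four summands
  are the failure probabilities for degrees, expansion, diameter and common neighbours.\<close>

lemma prob_query_complexity_ge:
  fixes \<delta> \<epsilon> \<eta> p :: real
  assumes k: "1 \<le> k" and \<epsilon>: "0 < \<epsilon>" and n: "2 \<le> n" "1 / real n \<le> \<delta>"
    and p: "0 < p" "p \<le> 1" and np: "2 \<le> real n * p" "1 / \<delta> \<le> real n * p" "1 \<le> \<eta> * (real n * p)"
    and \<eta>: "0 < \<eta>" "\<eta> \<le> 1 / 10" "\<eta> \<le> \<delta>"
    and \<delta>: "0 < \<delta>" "\<delta> < 1" "0 \<le> 1 - \<delta> - 2 * (1 + \<delta>) * \<delta>"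
      "(real k + 1) * (1 + \<delta>) ^ k \<le> (1 - \<delta> - 2 * (1 + \<delta>) * \<delta>) * (1 - \<delta>) * (real k + 1 + \<epsilon>)"
  shows "1 - (real n * exp (- ((1 + \<delta>) * ln (1 + \<delta>) - \<delta>) * (real n * p))
        + (exp (real n * exp (- (\<eta>\<^sup>2 * (real n * p)))) - 1)
        + (real n)\<^sup>2 * (exp (- ((1 - 5 * \<eta>) ^ (k + 1) * (real n ^ (k + 1) * p ^ (k + 2))))
                     + exp (- ((1 - 5 * \<eta>) * \<eta> / 2 * (real n * p))))
        + (real n)\<^sup>2 * (2 * exp (- (\<eta>\<^sup>2 * (real n - 2) / 2))))
    \<le> measure_pmf.prob (gnp n p) {G. real (query_complexity n G)
          \<ge> 1 / (2 * (real k + 1 + \<epsilon>) * real n powi (int k - 2) * p ^ k)}"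
    (is "1 - (?b1 + ?b2 + ?b3 + ?b4) \<le> measure_pmf.prob ?M ?S")
proof -
  have nonneg: "0 \<le> ?b1" "0 \<le> ?b2" "0 \<le> ?b3" "0 \<le> ?b4" by auto
  show ?thesis
  proof (cases "p \<le> \<eta>")
    case True
    let ?B1 = "{G. \<exists>x\<in>{1..n}. (1 + \<delta>) * (real n * p) \<le> real (card {v \<in> {1..n} - {x}. {x, v} \<in> G})}"
    let ?B2 = "{G. \<not> expanding n p \<eta> G}"
    let ?B3 = "{G. \<exists>x\<in>{1..n}. \<exists>y\<in>{1..n}. x \<noteq> y \<and> expanding n p \<eta> G \<and> \<not> graph_dist G x y \<le> enat (k + 2)}"
    have "measure_pmf.prob ?M (?B1 \<union> ?B2 \<union> ?B3) \<le> measure_pmf.prob ?M (?B1 \<union> ?B2) + measure_pmf.prob ?M ?B3"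
      by (intro measure_Un_le) auto
    also have "measure_pmf.prob ?M (?B1 \<union> ?B2) \<le> measure_pmf.prob ?M ?B1 + measure_pmf.prob ?M ?B2"
      by (intro measure_Un_le) auto
    also have "measure_pmf.prob ?M ?B1 \<le> ?b1"
      using p \<delta> by (intro prob_some_degree_large) auto
    also have "measure_pmf.prob ?M ?B2 \<le> ?b2"
      using p np \<eta> by (intro prob_not_expanding) auto
    also have "measure_pmf.prob ?M ?B3 \<le> ?b3"
      by (rule prob_diameter_large[OF p(1) True \<eta>(2) np(3,1)])
    finally have "measure_pmf.prob ?M (?B1 \<union> ?B2 \<union> ?B3) \<le> ?b1 + ?b2 + ?b3 + ?b4"
      using nonneg(4) by linarith
    then show ?thesis
    proof (rule prob_ge_one_minus[rotated])
      fix G assume G: "G \<in> set_pmf ?M" "G \<notin> ?B1 \<union> ?B2 \<union> ?B3"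
      show "G \<in> ?S"
      proof (intro CollectI sparse_query_complexity_ge[OF set_pmf_gnp[OF G(1)], where \<delta> = \<delta>])
        show "real (card {v \<in> {1..n} - {x}. {x, v} \<in> G}) \<le> (1 + \<delta>) * (real n * p)" if "x \<in> {1..n}" for x
          using G(2) that by (auto simp: not_le intro: less_imp_le)
        show "graph_dist G x y \<le> enat (k + 2)" if "x \<in> {1..n}" "y \<in> {1..n}" "x \<noteq> y" for x y
          using G(2) that by blast
      qed (use n p np \<eta> \<delta> \<epsilon> True in auto)
    qed
  next
    case False
    let ?B = "{G. \<exists>x\<in>{1..n}. \<exists>y\<in>{1..n}. x \<noteq> y \<and> card {w \<in> {1..n} - {x, y}. {x, w} \<in> G \<and> {w, y} \<in> G} < 2}"
    have "measure_pmf.prob ?M ?B \<le> ?b4"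
    proof (rule prob_pair_union_le)
      fix x y assume "x \<in> {1..n}" "y \<in> {1..n}" "x \<noteq> y"
      then have "measure_pmf.prob ?M {G. card {w \<in> {1..n} - {x, y}. {x, w} \<in> G \<and> {w, y} \<in> G} < 2}
          \<le> 2 * exp (- (p\<^sup>2 * (real n - 2) / 2))"
        using p by (intro prob_few_common_neighbours) auto
      also have "\<dots> \<le> 2 * exp (- (\<eta>\<^sup>2 * (real n - 2) / 2))"
        using False \<eta> n by (auto intro!: mult_right_mono power_mono)
      finally show "measure_pmf.prob ?M {G. card {w \<in> {1..n} - {x, y}. {x, w} \<in> G \<and> {w, y} \<in> G} < 2}
          \<le> 2 * exp (- (\<eta>\<^sup>2 * (real n - 2) / 2))" .
    qed simp
    then have "measure_pmf.prob ?M ?B \<le> ?b1 + ?b2 + ?b3 + ?b4" using nonneg by linarith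
    then show ?thesis
    proof (rule prob_ge_one_minus[rotated])
      fix G assume G: "G \<in> set_pmf ?M" "G \<notin> ?B"
      have "2 \<le> card {w \<in> {1..n} - {x, y}. {x, w} \<in> G \<and> {w, y} \<in> G}"
        if "x \<in> {1..n}" "y \<in> {1..n}" "x \<noteq> y" for x y
        using G(2) that not_le by blast
      then show "G \<in> ?S"
        using n np k \<epsilon> by (intro CollectI dense_query_complexity_ge[OF set_pmf_gnp[OF G(1)]]) auto
    qed
  qed
qed

text \<open>This is where the constant 2 in \<open>2 * ln n + \<omega> n\<close> is needed: the exponent must beat the number of
  pairs. With \<open>\<eta> = 1 / (ln n)\<^sup>2\<close> the relative loss \<open>5 * (k + 1) * \<eta>\<close> in the exponent tends to 0 even after
  multiplication by \<open>ln n\<close>, so half of \<open>\<omega> n\<close> survives.\<close>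

lemma far_pairs_vanish:
  fixes \<omega> :: "nat \<Rightarrow> real"
  assumes "filterlim \<omega> at_top sequentially"
  shows "(\<lambda>n. (real n)\<^sup>2 * exp (- ((1 - 5 * (1 / (ln (real n))\<^sup>2)) ^ (k + 1) * (2 * ln (real n) + \<omega> n))))
    \<longlonglongrightarrow> 0"
proof (rule Lim_null_comparison)
  have "\<forall>\<^sub>F n in sequentially. 5 * (real k + 1) * (1 / (ln (real n))\<^sup>2) \<le> 1 / 2"
    by real_asymp
  moreover have "\<forall>\<^sub>F n in sequentially. 0 \<le> \<omega> n"
    using assms by (simp add: filterlim_at_top)
  moreover have "\<forall>\<^sub>F n::nat in sequentially. 0 < ln (real n)" by real_asymp
  moreover have "\<forall>\<^sub>F n::nat in sequentially. 0 < n" by (rule eventually_gt_at_top)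
  ultimately show "\<forall>\<^sub>F n in sequentially.
      norm ((real n)\<^sup>2 * exp (- ((1 - 5 * (1 / (ln (real n))\<^sup>2)) ^ (k + 1) * (2 * ln (real n) + \<omega> n))))
      \<le> exp (10 * (real k + 1) / ln (real n)) * exp (- (\<omega> n / 2))"
  proof eventually_elim
    case (elim n)
    define L where "L = ln (real n)"
    define h where "h = 5 * (real k + 1) * (1 / L\<^sup>2)"
    have h: "h \<le> 1 / 2" "0 < L" "0 \<le> \<omega> n" using elim by (simp_all add: h_def L_def)
    have "1 - 5 * (1 / L\<^sup>2) \<ge> 0"
    proof -
      have "5 * (1 / L\<^sup>2) * 1 \<le> 5 * (1 / L\<^sup>2) * (real k + 1)" by (intro mult_left_mono) auto
      then have "5 * (1 / L\<^sup>2) \<le> h" by (simp add: h_def mult_ac)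
      then show ?thesis using h(1) by linarith
    qed
    then have "1 + real (k + 1) * - (5 * (1 / L\<^sup>2)) \<le> (1 + - (5 * (1 / L\<^sup>2))) ^ (k + 1)"
      by (intro Bernoulli_inequality) simp
    moreover have "1 + real (k + 1) * - (5 * (1 / L\<^sup>2)) = 1 - h"
      by (simp add: h_def algebra_simps add_divide_distrib)
    ultimately have "1 - h \<le> (1 - 5 * (1 / L\<^sup>2)) ^ (k + 1)" by simp
    then have "(1 - h) * (2 * L + \<omega> n) \<le> (1 - 5 * (1 / L\<^sup>2)) ^ (k + 1) * (2 * L + \<omega> n)"
      using h by (intro mult_right_mono) auto
    moreover have "h * \<omega> n \<le> 1 / 2 * \<omega> n" using h by (intro mult_right_mono) auto
    moreover have "2 * (h * L) = 10 * (real k + 1) / L"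
      using h by (simp add: h_def power2_eq_square)
    ultimately have "2 * L - (1 - 5 * (1 / L\<^sup>2)) ^ (k + 1) * (2 * L + \<omega> n)
        \<le> 10 * (real k + 1) / L - \<omega> n / 2"
      by (simp add: algebra_simps)
    then have "exp (2 * L) * exp (- ((1 - 5 * (1 / L\<^sup>2)) ^ (k + 1) * (2 * L + \<omega> n)))
        \<le> exp (10 * (real k + 1) / L) * exp (- (\<omega> n / 2))"
      by (simp add: exp_add[symmetric])
    moreover have "exp (2 * L) = (real n)\<^sup>2"
      using elim by (simp add: L_def exp_double)
    ultimately show ?case by (simp add: L_def)
  qed
  have "(\<lambda>n. exp (10 * (real k + 1) / ln (real n))) \<longlonglongrightarrow> 1" by real_asymp
  moreover have "(\<lambda>n. exp (- (\<omega> n / 2))) \<longlonglongrightarrow> 0"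
  proof -
    have "filterlim (\<lambda>n. \<omega> n * (1 / 2)) at_top sequentially"
      by (rule filterlim_at_top_mult_tendsto_pos[OF tendsto_const _ assms]) simp
    then have "filterlim (\<lambda>n. - (\<omega> n / 2)) at_bot sequentially"
      by (simp add: filterlim_uminus_at_bot)
    then show ?thesis by (rule filterlim_compose[OF exp_at_bot])
  qed
  ultimately show "(\<lambda>n. exp (10 * (real k + 1) / ln (real n)) * exp (- (\<omega> n / 2))) \<longlonglongrightarrow> 0"
    using tendsto_mult by fastforce
qed

theorem theorem2:
  fixes k :: nat and \<epsilon> :: real and \<omega> p :: "nat \<Rightarrow> real"
  assumes "k \<ge> 1" and "\<epsilon> > 0"
    and "filterlim \<omega> at_top sequentially"
    and "\<And>n. 0 \<le> p n \<and> p n \<le> 1"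
    and "\<forall>\<^sub>F n in sequentially.
           p n = ((2 * ln (real n) + \<omega> n) / real n ^ (k + 1)) powr (1 / real (k + 2))"
  shows "(\<lambda>n. measure_pmf.prob (gnp n (p n))
            {G. real (query_complexity n G)
                  \<ge> 1 / (2 * (real k + 1 + \<epsilon>) * real n powi (int k - 2) * p n ^ k)})
         \<longlonglongrightarrow> 1"
proof -
  obtain \<delta> where \<delta>: "0 < \<delta>" "\<delta> < 1" "0 \<le> 1 - \<delta> - 2 * (1 + \<delta>) * \<delta>"
    "(real k + 1) * (1 + \<delta>) ^ k \<le> (1 - \<delta> - 2 * (1 + \<delta>) * \<delta>) * (1 - \<delta>) * (real k + 1 + \<epsilon>)"
    using exists_small_delta[OF assms(2)] by blast
  define \<alpha> where "\<alpha> = 1 / real (k + 2)"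
  define c where "c = (1 + \<delta>) * ln (1 + \<delta>) - \<delta>"
  define \<eta> where "\<eta> n = 1 / (ln (real n))\<^sup>2" for n :: nat
  define u where "u n = 2 * ln (real n) + \<omega> n" for n
  \<comment> \<open>The failure probability with \<open>n * p\<close> replaced by its lower bound \<open>n powr \<alpha>\<close>.\<close>
  define b where "b n = real n * exp (- c * real n powr \<alpha>)
      + (exp (real n * exp (- ((\<eta> n)\<^sup>2 * real n powr \<alpha>))) - 1)
      + ((real n)\<^sup>2 * exp (- ((1 - 5 * \<eta> n) ^ (k + 1) * u n))
       + (real n)\<^sup>2 * exp (- ((1 - 5 * \<eta> n) * \<eta> n / 2 * real n powr \<alpha>)))
      + (real n)\<^sup>2 * (2 * exp (- ((\<eta> n)\<^sup>2 * (real n - 2) / 2)))" for n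
  let ?P = "\<lambda>n. measure_pmf.prob (gnp n (p n))
            {G. real (query_complexity n G)
                  \<ge> 1 / (2 * (real k + 1 + \<epsilon>) * real n powi (int k - 2) * p n ^ k)}"
  have \<alpha>: "0 < \<alpha>" by (simp add: \<alpha>_def)
  have c: "0 < c" unfolding c_def using \<delta>(1) by (rule degree_exponent_pos)
  have "(\<lambda>n. real n * exp (- c * real n powr \<alpha>)) \<longlonglongrightarrow> 0"
    using \<alpha> c by real_asymp
  moreover have "(\<lambda>n. exp (real n * exp (- ((\<eta> n)\<^sup>2 * real n powr \<alpha>))) - 1) \<longlonglongrightarrow> 0"
    unfolding \<eta>_def using \<alpha> by real_asymp
  moreover have "(\<lambda>n. (real n)\<^sup>2 * exp (- ((1 - 5 * \<eta> n) ^ (k + 1) * u n))) \<longlonglongrightarrow> 0"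
    unfolding \<eta>_def u_def using assms(3) by (rule far_pairs_vanish)
  moreover have "(\<lambda>n. (real n)\<^sup>2 * exp (- ((1 - 5 * \<eta> n) * \<eta> n / 2 * real n powr \<alpha>))) \<longlonglongrightarrow> 0"
    unfolding \<eta>_def using \<alpha> by real_asymp
  moreover have "(\<lambda>n. (real n)\<^sup>2 * (2 * exp (- ((\<eta> n)\<^sup>2 * (real n - 2) / 2)))) \<longlonglongrightarrow> 0"
    unfolding \<eta>_def by real_asymp
  ultimately have "b \<longlonglongrightarrow> 0 + 0 + (0 + 0) + 0"
    unfolding b_def by (intro tendsto_add)
  then have lim: "(\<lambda>n. 1 - b n) \<longlonglongrightarrow> 1" using tendsto_diff[OF tendsto_const, of b 0 _ 1] by simp
  have "\<forall>\<^sub>F n in sequentially. 1 \<le> \<eta> n * real n powr \<alpha>"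
    unfolding \<eta>_def using \<alpha> by real_asymp
  moreover have "\<forall>\<^sub>F n in sequentially. max 2 (1 / \<delta>) \<le> real n powr \<alpha>"
    using \<alpha> by real_asymp
  moreover have "\<forall>\<^sub>F n in sequentially. \<eta> n < min (1 / 10) \<delta>"
  proof -
    have "\<eta> \<longlonglongrightarrow> 0" unfolding \<eta>_def by real_asymp
    then show ?thesis using \<delta>(1) by (intro order_tendstoD) auto
  qed
  moreover have "\<forall>\<^sub>F n in sequentially. 1 / real n \<le> \<delta>" using \<delta>(1) by real_asymp
  moreover have "\<forall>\<^sub>F n in sequentially. 1 \<le> \<omega> n" using assms(3) by (simp add: filterlim_at_top)
  moreover have "\<forall>\<^sub>F n::nat in sequentially. 3 \<le> n" by (rule eventually_ge_at_top)
  ultimately have lower: "\<forall>\<^sub>F n in sequentially. 1 - b n \<le> ?P n"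
    using assms(5)
  proof eventually_elim
    case (elim n)
    have n: "0 < real n" "1 < real n" using elim by auto
    have L: "0 < ln (real n)" using n by simp
    then have u1: "1 \<le> u n" using elim(5) unfolding u_def by linarith
    have \<eta>0: "0 < \<eta> n" using L by (simp add: \<eta>_def)
    have p0: "0 < p n" using elim u1 n by (simp add: u_def)
    have "p n ^ (k + 2) = p n powr real (k + 2)" by (rule powr_realpow[OF p0, symmetric])
    also have "\<dots> = u n / real n ^ (k + 1)"
      using elim(7) u1 n by (simp add: powr_powr u_def)
    finally have pk: "real n ^ (k + 1) * p n ^ (k + 2) = u n" using n by simp
    have np: "real n powr \<alpha> \<le> real n * p n"
    proof -
      have "real n * 1 \<le> real n * u n" using u1 n by (intro mult_left_mono) auto
      also have "\<dots> = (real n * p n) ^ (k + 2)"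
        by (simp add: pk[symmetric] power_mult_distrib)
      also have "\<dots> = (real n * p n) powr real (k + 2)"
        using n p0 by (intro powr_realpow[symmetric] mult_pos_pos) auto
      finally have "real n \<le> (real n * p n) powr real (k + 2)" by simp
      then have "real n powr \<alpha> \<le> ((real n * p n) powr real (k + 2)) powr \<alpha>"
        using \<alpha> n by (intro powr_mono2) auto
      also have "\<dots> = real n * p n" using n p0 by (simp add: powr_powr \<alpha>_def)
      finally show ?thesis .
    qed
    have scale: "s * real n powr \<alpha> \<le> s * (real n * p n)" if "0 \<le> s" for s
      using that np by (rule mult_left_mono[rotated])
    have "1 - b n \<le> 1 - (real n * exp (- c * (real n * p n))
        + (exp (real n * exp (- ((\<eta> n)\<^sup>2 * (real n * p n)))) - 1)
        + (real n)\<^sup>2 * (exp (- ((1 - 5 * \<eta> n) ^ (k + 1) * (real n ^ (k + 1) * p n ^ (k + 2))))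
                     + exp (- ((1 - 5 * \<eta> n) * \<eta> n / 2 * (real n * p n))))
        + (real n)\<^sup>2 * (2 * exp (- ((\<eta> n)\<^sup>2 * (real n - 2) / 2))))"
      unfolding b_def pk distrib_left
    proof (intro diff_left_mono add_mono order_refl diff_right_mono mult_left_mono)
      show "exp (- c * (real n * p n)) \<le> exp (- c * real n powr \<alpha>)"
        using scale[of c] c by simp
      have "exp (- ((\<eta> n)\<^sup>2 * (real n * p n))) \<le> exp (- ((\<eta> n)\<^sup>2 * real n powr \<alpha>))"
        using scale[of "(\<eta> n)\<^sup>2"] by simp
      then show "exp (real n * exp (- ((\<eta> n)\<^sup>2 * (real n * p n))))
          \<le> exp (real n * exp (- ((\<eta> n)\<^sup>2 * real n powr \<alpha>)))"
        using n by simp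
      have "0 \<le> (1 - 5 * \<eta> n) * \<eta> n / 2" using elim(3) \<eta>0 by simp
      from scale[OF this] show "exp (- ((1 - 5 * \<eta> n) * \<eta> n / 2 * (real n * p n)))
          \<le> exp (- ((1 - 5 * \<eta> n) * \<eta> n / 2 * real n powr \<alpha>))" by simp
    qed auto
    also have "\<dots> \<le> ?P n"
      unfolding c_def
    proof (rule prob_query_complexity_ge[OF assms(1,2)])
      show "1 \<le> \<eta> n * (real n * p n)" using elim(1) scale[of "\<eta> n"] \<eta>0 by linarith
    qed (use elim(2,3,4,6) \<delta> p0 np \<eta>0 assms(4) in auto)
    finally show ?case .
  qed
  show ?thesis
    by (rule tendsto_sandwich[OF lower _ lim tendsto_const]) auto
qed

end
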